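(* Let $(\mathbf{x}(\cdot),\mathbf{v}(\cdot))$ be a solution of the delayed Cucker–Smale system with possibly nonsymmetric weights $$\dot x_i(t)=v_i(t),\qquad \dot v_i(t)=\frac{\lambda}{N}\sum_{j\neq i}a_{ij}(t-\tau(t))\,\bigl(v_j(t-\tau(t))-v_i(t)\bigr),\qquad i=1,\dots,N,\ t>0,$$ under the standing assumptions listed in the context. Assume that there exists $\psi^*>0$ such that, for all $t\ge-\tau(0)$, $$\frac1{N^2}\sum_{i,j=1}^N\min\bigl(a_{qi}(t)a_{pj}(t),\,a_{qj}(t)a_{pi}(t)\bigr)\ge\psi^*\qquad\text{for all } p,q=1,\dots,N.$$ Set $$\tau_0=\frac{1-c}{\lambda}\,\frac{\psi^*}{\psi^*+2}.$$ If $\overline\tau e^{\overline\tau}\in(0,\tau_0)$, then $$d_V(t)\le Ce^{-rt}\qquad\text{for all } t\ge0,$$ with $$r=\min\left\{\lambda\left(\psi^*-\frac{2\lambda\overline\tau}{(1-c)e^{-\overline\tau}-\lambda\overline\tau}\right),\ 1\right\},$$ $$C=d_V(0)+\frac{2\lambda}{(1-c)e^{-\overline\tau}-\lambda\overline\tau}\int_{-\tau(0)}^0e^{s}\int_s^0\max_{j=1,\dots,N}|\dot v_j(\sigma)|\,d\sigma\,ds .$$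
   Context: Setting. $N\ge2$ and $d\ge1$ are integers, $\lambda>0$ is a coupling strength, and $|\cdot|$ is the Euclidean norm on $\mathbb{R}^d$. For $i=1,\dots,N$, $x_i(t),v_i(t)\in\mathbb{R}^d$ are the position and velocity of the $i$-th agent. Delay. $\tau:[0,+\infty)\to[0,+\infty)$ is Lipschitz continuous (hence almost everywhere differentiable), there is $\overline\tau>0$ with $0\le\tau(t)\le\overline\tau$ for all $t>0$, and there is a constant $0<c<1$ with $|\tau'(t)|\le c$ for almost every $t>0$. (In particular $t-\tau(t)\ge-\tau(0)$ for all $t\ge0$.) Weights. For $i\ne j$, $a_{ij}(t)>0$ are the communication rates, continuous functions of $t\in[-\tau(0),+\infty)$ along the solution (they may depend on the solution itself, for instance through the positions $x_k(t)$), not necessarily symmetric in $i,j$, and satisfying $\frac1N\sum_{j\ne i}a_{ij}(t)<1$ for all $i$ and $t$. One sets $a_{ii}(t)=N-\sum_{j\ne i}a_{ij}(t)$, so that $\sum_{j=1}^Na_{ij}(t)=N$ for every $i$. Initial data and solutions. $x_i(t)=f_i(t)$, $v_i(t)=g_i(t)$ for $t\in[-\tau(0),0]$, where $f_i,g_i:[-\tau(0),0]\to\mathbb{R}^d$ are given, $f_i$ is continuous, and $g_i$ is absolutely continuous; on $[-\tau(0),0]$, $\dot v_i$ means $\dot g_i$. A solution is a pair of continuous functions on $[-\tau(0),+\infty)$ with these initial data, satisfying the differential equations for $t>0$. Velocity diameter. $d_V(t)=\max_{i,j}|v_j(t)-v_i(t)|$. *)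

theory Defs
  imports "HOL-Analysis.Analysis"
begin

text \<open>
  Absolute continuity on a real interval \<open>S\<close>, in the classical epsilon-delta form with finite
  families of non-overlapping subintervals.  (The library constant \<open>absolutely_continuous\<close> is the
  unrelated notion for measures.)
\<close>

definition abs_continuous_on :: "real set \<Rightarrow> (real \<Rightarrow> 'a::real_normed_vector) \<Rightarrow> bool" where
  "abs_continuous_on S f \<longleftrightarrow>
     (\<forall>\<epsilon>>0. \<exists>\<delta>>0. \<forall>(n::nat) (\<alpha>::nat \<Rightarrow> real) (\<beta>::nat \<Rightarrow> real).
        (\<forall>k<n. \<alpha> k \<le> \<beta> k \<and> {\<alpha> k..\<beta> k} \<subseteq> S) \<and>
        disjoint_family_on (\<lambda>k. {\<alpha> k<..<\<beta> k}) {..<n} \<and>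
        (\<Sum>k<n. \<beta> k - \<alpha> k) < \<delta>
        \<longrightarrow> (\<Sum>k<n. norm (f (\<beta> k) - f (\<alpha> k))) < \<epsilon>)"

text \<open>
  Throughout, agents are numbered by \<open>{1..N}\<close>; a function such as \<open>x :: nat \<Rightarrow> real \<Rightarrow> real ^ 'd\<close>
  maps the agent and the time to a vector, and values outside \<open>{1..N}\<close> or outside the time interval
  under consideration are irrelevant.
\<close>

definition velocity_diameter :: "nat \<Rightarrow> (nat \<Rightarrow> real \<Rightarrow> real ^ 'd) \<Rightarrow> real \<Rightarrow> real" where
  "velocity_diameter N v t = Max {norm (v j t - v i t) | i j. i \<in> {1..N} \<and> j \<in> {1..N}}"

text \<open>
  Time delay.  Since \<open>\<tau>\<close> is Lipschitz, it is differentiable almost everywhere; the existence of the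
  derivative is part of reading the almost-everywhere bound on it.
\<close>

definition admissible_delay :: "(real \<Rightarrow> real) \<Rightarrow> real \<Rightarrow> real \<Rightarrow> bool" where
  "admissible_delay \<tau> \<tau>bar c \<longleftrightarrow>
     (\<exists>L. L-lipschitz_on {0..} \<tau>) \<and>
     (\<forall>t\<ge>0. 0 \<le> \<tau> t) \<and>
     0 < \<tau>bar \<and> (\<forall>t>0. \<tau> t \<le> \<tau>bar) \<and>
     0 < c \<and> c < 1 \<and>
     (AE t in lebesgue. 0 < t \<longrightarrow> (\<exists>D. (\<tau> has_real_derivative D) (at t) \<and> \<bar>D\<bar> \<le> c))"

text \<open>
  Communication rates evaluated along the solution, as functions of time from \<open>t0\<close> (later \<open>- \<tau> 0\<close>)
  onwards.  Any dependence on the state has already been composed into \<open>a i j\<close>.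
\<close>

definition admissible_weights :: "nat \<Rightarrow> real \<Rightarrow> (nat \<Rightarrow> nat \<Rightarrow> real \<Rightarrow> real) \<Rightarrow> bool" where
  "admissible_weights N t0 a \<longleftrightarrow>
     (\<forall>i\<in>{1..N}. \<forall>j\<in>{1..N}. i \<noteq> j \<longrightarrow> continuous_on {t0..} (a i j) \<and> (\<forall>t\<ge>t0. 0 < a i j t)) \<and>
     (\<forall>i\<in>{1..N}. \<forall>t\<ge>t0. 1 / real N * (\<Sum>j\<in>{1..N} - {i}. a i j t) < 1) \<and>
     (\<forall>i\<in>{1..N}. \<forall>t\<ge>t0. a i i t = real N - (\<Sum>j\<in>{1..N} - {i}. a i j t))"

definition delayed_CS_solution ::
  "nat \<Rightarrow> real \<Rightarrow> (real \<Rightarrow> real) \<Rightarrow> (nat \<Rightarrow> nat \<Rightarrow> real \<Rightarrow> real) \<Rightarrow>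
   (nat \<Rightarrow> real \<Rightarrow> real ^ 'd) \<Rightarrow> (nat \<Rightarrow> real \<Rightarrow> real ^ 'd) \<Rightarrow>
   (nat \<Rightarrow> real \<Rightarrow> real ^ 'd) \<Rightarrow> (nat \<Rightarrow> real \<Rightarrow> real ^ 'd) \<Rightarrow> bool" where
  "delayed_CS_solution N lam \<tau> a f g x v \<longleftrightarrow>
     (\<forall>i\<in>{1..N}.
        continuous_on {- \<tau> 0..} (x i) \<and> continuous_on {- \<tau> 0..} (v i) \<and>
        (\<forall>t\<in>{- \<tau> 0..0}. x i t = f i t \<and> v i t = g i t) \<and>
        (\<forall>t>0. (x i has_vector_derivative v i t) (at t) \<and>
               (v i has_vector_derivative
                  (lam / real N) *\<^sub>R
                    (\<Sum>j\<in>{1..N} - {i}. a i j (t - \<tau> t) *\<^sub>R (v j (t - \<tau> t) - v i t))) (at t)))"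

end

theory Submission
  imports Defs
begin

text \<open>
  Let \<open>d(t)\<close> be the velocity diameter and \<open>\<sigma>(t)\<close> the integral of \<open>max\<^sub>j |v\<^sub>j'|\<close> over
  \<open>[t - \<tau>(t), t]\<close>, which bounds the displacement of every velocity during one delay.  Replacing
  the delayed velocities \<open>v\<^sub>j(t - \<tau>(t))\<close> by the current ones turns the equation into
  \<open>v\<^sub>i' = \<lambda> (m\<^sub>i - v\<^sub>i) + e\<^sub>i\<close>, where \<open>m\<^sub>i\<close> is the mean of the current velocities with the weights
  \<open>a\<^sub>i\<^sub>j / N\<close> and \<open>|e\<^sub>i| \<le> \<lambda> \<sigma>\<close>, since the off-diagonal weights sum to less than \<open>N\<close>
  (\<open>delayed_rate_perturbation\<close>).  The hypothesis on the weights says that two such weight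
  distributions overlap in mass \<open>\<psi>\<close>, so two means differ by at most \<open>(1 - \<psi>) d\<close>
  (\<open>convex_means_contract\<close>).  Hence, with \<open>D\<close> the upper right Dini derivative,
  \<open>D d \<le> - \<lambda> \<psi> d + 2 \<lambda> \<sigma>\<close> (\<open>velocity_diameter_dini\<close>), and the same decomposition gives
  \<open>max\<^sub>j |v\<^sub>j'| \<le> \<lambda> d + \<lambda> \<sigma>\<close>.

  The error \<open>\<sigma>\<close> is absorbed by a memory functional.  Let \<open>\<Phi>\<close> be a primitive of \<open>max\<^sub>j |v\<^sub>j'|\<close>, so
  that \<open>\<sigma>(t) = \<Phi>(t) - \<Phi>(t - \<tau>(t))\<close>, and let \<open>W(t)\<close> be the integral of
  \<open>e\<^bsup>s - t\<^esup> (\<Phi>(t) - \<Phi>(s))\<close> over \<open>s\<close> in \<open>[t - \<tau>(t), t]\<close>.  The left end of this interval moves to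
  the right with speed at least \<open>1 - c\<close>, whence
  \<open>D W \<le> \<tau>bar max\<^sub>j |v\<^sub>j'| - W - (1 - c) e\<^bsup>-\<tau>bar\<^esup> \<sigma>\<close> (\<open>memory_term_dini\<close>).  With
  \<open>\<kappa> = (1 - c) e\<^bsup>-\<tau>bar\<^esup> - \<lambda> \<tau>bar\<close> and \<open>\<beta> = 2 \<lambda> / \<kappa>\<close> the terms in \<open>\<sigma>\<close> cancel in the derivative of
  \<open>L = d + \<beta> W\<close>, and there remains
  \<open>D L \<le> - (\<lambda> \<psi> - \<beta> \<lambda> \<tau>bar) d - \<beta> W \<le> - r L\<close>.  Therefore \<open>d(t) \<le> L(t) \<le> L(0) e\<^bsup>-r t\<^esup>\<close>
  (\<open>upper_dini_exp_decay\<close>), and \<open>L(0) = C\<close>.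

  Two facts about absolutely continuous functions enter.  The initial velocities are only absolutely
  continuous, so for \<open>C\<close> to control their increments the derivative has to exist almost
  everywhere, be Lebesgue integrable, and have the function as its primitive
  (\<open>abs_continuous_derivative_absolutely_integrable\<close>).  Likewise the almost everywhere bound on the
  derivative of the delay has to be turned into a Lipschitz bound (\<open>admissible_delay_lipschitz\<close>).
  Differentiability almost everywhere is reduced, through the variation function, to Lebesgue's
  theorem on monotone functions (\<open>mono_differentiable_almost_everywhere\<close>), which follows from the
  Vitali covering theorem.  The fundamental theorem of calculus is proved for the gauge integral,
  where absolute continuity controls exactly the contribution of the tags in the exceptional
  null set.
\<close>

text \<open>
  \<open>steep_at F v x\<close> and \<open>flat_at F v x\<close> say that arbitrarily short intervals containing \<open>x\<close> have
  difference quotients at least, respectively at most, \<open>v\<close>.  The point may be an end point of the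
  interval, so one-sided quotients are included, and the intervals around a set form a Vitali
  cover of it.
\<close>

section \<open>Monotone functions are differentiable almost everywhere\<close>

definition steep_at :: "(real \<Rightarrow> real) \<Rightarrow> real \<Rightarrow> real \<Rightarrow> bool" where
  "steep_at F v x \<longleftrightarrow> (\<forall>d>0. \<exists>s t. s \<le> x \<and> x \<le> t \<and> s < t \<and> t - s < d \<and> v * (t - s) \<le> F t - F s)"

definition flat_at :: "(real \<Rightarrow> real) \<Rightarrow> real \<Rightarrow> real \<Rightarrow> bool" where
  "flat_at F u x \<longleftrightarrow> (\<forall>d>0. \<exists>s t. s \<le> x \<and> x \<le> t \<and> s < t \<and> t - s < d \<and> F t - F s \<le> u * (t - s))"

lemma mono_increments_disjoint_le:
  fixes F :: "real \<Rightarrow> real" and \<alpha> \<beta> :: "'i \<Rightarrow> real"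
  assumes F: "mono F" and "A \<le> B"
    and fin: "finite I"
    and le: "\<And>i. i \<in> I \<Longrightarrow> \<alpha> i \<le> \<beta> i" "\<And>i. i \<in> I \<Longrightarrow> A \<le> \<alpha> i" "\<And>i. i \<in> I \<Longrightarrow> \<beta> i \<le> B"
    and disj: "pairwise (\<lambda>i j. disjnt {\<alpha> i..\<beta> i} {\<alpha> j..\<beta> j}) I"
  shows "(\<Sum>i\<in>I. F (\<beta> i) - F (\<alpha> i)) \<le> F B - F A"
  using fin \<open>A \<le> B\<close> le disj
proof (induction I arbitrary: B rule: finite_ranking_induct[where f = \<alpha>])
  case empty
  then show ?case using F by (simp add: monoD)
next
  case (insert i I)
  show ?case
  proof (cases "i \<in> I")
    case True
    then show ?thesis using insert by (simp add: insert_absorb)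
  next
    case False
    \<comment> \<open>The intervals other than the rightmost one lie in \<open>[A, \<alpha> i]\<close>.\<close>
    have "\<beta> j \<le> \<alpha> i" if j: "j \<in> I" for j
    proof -
      have "disjnt {\<alpha> j..\<beta> j} {\<alpha> i..\<beta> i}"
        using insert.prems(5) j False by (auto simp: pairwise_def)
      moreover have "\<alpha> j \<le> \<alpha> i" "\<alpha> i \<le> \<beta> i" "\<alpha> j \<le> \<beta> j" using insert j by auto
      ultimately show ?thesis by (force simp: disjnt_iff)
    qed
    then have "(\<Sum>i\<in>I. F (\<beta> i) - F (\<alpha> i)) \<le> F (\<alpha> i) - F A"
      using insert.prems by (intro insert.IH) (auto simp: pairwise_insert)
    moreover have "F (\<beta> i) \<le> F B" using insert.prems F by (simp add: monoD)
    ultimately show ?thesis using insert.hyps False by simp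
  qed
qed

text \<open>
  A compact interval is the closed ball around its midpoint, so the Vitali covering theorem for balls
  applies.
\<close>

lemma Vitali_covering_intervals:
  fixes S :: "real set" and P :: "real \<Rightarrow> real \<Rightarrow> bool"
  assumes cov: "\<And>x d. \<lbrakk>x \<in> S; 0 < d\<rbrakk> \<Longrightarrow> \<exists>s t. s \<le> x \<and> x \<le> t \<and> s < t \<and> t - s < d \<and> P s t"
  obtains I :: "(real \<times> real) set" where "countable I"
    "\<And>i. i \<in> I \<Longrightarrow> fst i < snd i \<and> P (fst i) (snd i)"
    "pairwise (\<lambda>i j. disjnt {fst i..snd i} {fst j..snd j}) I"
    "negligible (S - (\<Union>i\<in>I. {fst i..snd i}))"
proof -
  define K where "K = {i. fst i < snd i \<and> P (fst i) (snd i)}"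
  define m where "m i = (fst i + snd i) / 2" for i :: "real \<times> real"
  define \<rho> where "\<rho> i = (snd i - fst i) / 2" for i :: "real \<times> real"
  have cb: "cball (m i) (\<rho> i) = {fst i..snd i}" for i
    by (simp add: cball_eq_atLeastAtMost m_def \<rho>_def field_simps)
  obtain I where I: "countable I" "I \<subseteq> K"
     "pairwise (\<lambda>i j. disjnt (cball (m i) (\<rho> i)) (cball (m j) (\<rho> j))) I"
     "negligible (S - (\<Union>i \<in> I. cball (m i) (\<rho> i)))"
  proof (rule Vitali_covering_theorem_cballs)
    show "0 < \<rho> i" if "i \<in> K" for i
      using that by (auto simp: K_def \<rho>_def)
    show "\<exists>i. i \<in> K \<and> x \<in> cball (m i) (\<rho> i) \<and> \<rho> i < d" if x: "x \<in> S" "0 < d" for x d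
    proof -
      obtain s t where "s \<le> x" "x \<le> t" "s < t" "t - s < d" "P s t" using cov[OF x] by blast
      then show ?thesis
        by (intro exI[of _ "(s, t)"]) (auto simp: cb, auto simp: K_def \<rho>_def)
    qed
  qed
  then show thesis
    by (intro that[of I]) (auto simp: cb K_def)
qed

text \<open>
  The disjoint intervals selected by Vitali's theorem have total length at most \<open>1 / v\<close> times the sum of
  the increments of \<open>F\<close> over them, and by monotonicity that sum is at most \<open>F B - F A\<close>.  The set \<open>S\<close>
  may fail to be measurable, so its size is expressed through a superset \<open>M\<close>.
\<close>

lemma mono_steep_set_measure_le:
  fixes F :: "real \<Rightarrow> real"
  assumes F: "mono F" and "0 < v" and "A \<le> B" and S: "S \<subseteq> {A<..<B}"
    and steep: "\<And>x. x \<in> S \<Longrightarrow> steep_at F v x"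
  obtains M where "M \<in> lmeasurable" "S \<subseteq> M" "v * measure lebesgue M \<le> F B - F A"
proof -
  have cov: "\<exists>s t. s \<le> x \<and> x \<le> t \<and> s < t \<and> t - s < d \<and> (A < s \<and> t < B \<and> v * (t - s) \<le> F t - F s)"
    if "x \<in> S" "0 < d" for x d
  proof -
    have "A < x" "x < B" using S that by auto
    then have "0 < min d (min (x - A) (B - x))" using that by auto
    then obtain s t where "s \<le> x" "x \<le> t" "s < t" "t - s < min d (min (x - A) (B - x))"
        "v * (t - s) \<le> F t - F s"
      using steep[OF \<open>x \<in> S\<close>] unfolding steep_at_def by blast
    then show ?thesis by (intro exI[of _ s] exI[of _ t]) auto
  qed
  obtain I :: "(real \<times> real) set" where I: "countable I"
    "\<And>i. i \<in> I \<Longrightarrow> fst i < snd i \<and> (A < fst i \<and> snd i < B \<and> v * (snd i - fst i) \<le> F (snd i) - F (fst i))"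
    "pairwise (\<lambda>i j. disjnt {fst i..snd i} {fst j..snd j}) I"
    "negligible (S - (\<Union>i\<in>I. {fst i..snd i}))"
  proof (rule Vitali_covering_intervals[of S "\<lambda>s t. A < s \<and> t < B \<and> v * (t - s) \<le> F t - F s"])
    show "\<exists>s t. s \<le> x \<and> x \<le> t \<and> s < t \<and> t - s < d \<and> (A < s \<and> t < B \<and> v * (t - s) \<le> F t - F s)"
      if "x \<in> S" "0 < d" for x d using that by (rule cov)
  qed (rule that)
  have fin: "measure lebesgue (\<Union>i\<in>I'. {fst i..snd i}) \<le> (F B - F A) / v" if "I' \<subseteq> I" "finite I'" for I'
  proof -
    have "v * measure lebesgue (\<Union>i\<in>I'. {fst i..snd i}) \<le> v * (\<Sum>i\<in>I'. measure lebesgue {fst i..snd i})"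
      using \<open>0 < v\<close> \<open>finite I'\<close> by (intro mult_left_mono measure_UNION_le) auto
    also have "\<dots> = (\<Sum>i\<in>I'. v * (snd i - fst i))"
      unfolding sum_distrib_left using I(2) \<open>I' \<subseteq> I\<close>
      by (intro sum.cong refl) (auto simp: subset_iff less_imp_le)
    also have "\<dots> \<le> (\<Sum>i\<in>I'. F (snd i) - F (fst i))"
      using I(2) \<open>I' \<subseteq> I\<close> by (intro sum_mono) auto
    also have "\<dots> \<le> F B - F A"
    proof (rule mono_increments_disjoint_le[OF F \<open>A \<le> B\<close> \<open>finite I'\<close>])
      show "fst i \<le> snd i" "A \<le> fst i" "snd i \<le> B" if "i \<in> I'" for i
        using I(2)[of i] \<open>I' \<subseteq> I\<close> that by auto
      show "pairwise (\<lambda>i j. disjnt {fst i..snd i} {fst j..snd j}) I'"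
        by (rule pairwise_subset[OF I(3) \<open>I' \<subseteq> I\<close>])
    qed
    finally show ?thesis using \<open>0 < v\<close> by (simp add: field_simps)
  qed
  let ?U = "\<Union>i\<in>I. {fst i..snd i}"
  have U: "?U \<in> lmeasurable" "measure lebesgue ?U \<le> (F B - F A) / v"
    by (rule fmeasurable_UN_bound[OF I(1) _ fin] measure_UN_bound[OF I(1) _ fin]; simp)+
  show thesis
  proof
    show "?U \<union> (S - ?U) \<in> lmeasurable"
      using fmeasurable.Un[OF U(1) negligible_imp_measurable[OF I(4)]] .
    show "S \<subseteq> ?U \<union> (S - ?U)" by auto
    have "measure lebesgue (?U \<union> (S - ?U)) \<le> measure lebesgue ?U + measure lebesgue (S - ?U)"
      by (rule measure_Un_le) (use U(1) I(4) in \<open>auto dest: fmeasurableD negligible_imp_sets\<close>)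
    also have "\<dots> \<le> (F B - F A) / v" using U(2) I(4) by (simp add: negligible_imp_measure0)
    finally show "v * measure lebesgue (?U \<union> (S - ?U)) \<le> F B - F A"
      using \<open>0 < v\<close> by (simp only: pos_le_divide_eq mult.commute)
  qed
qed

text \<open>
  Two Vitali covers are nested: \<open>S\<close> is first covered by disjoint intervals on which \<open>F\<close> grows at
  rate at most \<open>u\<close>, and inside each of them by intervals on which it grows at rate at least \<open>v\<close>.
  Comparing the increments shows that the measure shrinks by the factor \<open>u / v\<close>.
\<close>

lemma mono_oscillating_slope_measure_le:
  fixes F :: "real \<Rightarrow> real"
  assumes F: "mono F" and "0 \<le> u" "0 < v" and U: "open U" "U \<in> lmeasurable" and S: "S \<subseteq> U"
    and flat: "\<And>x. x \<in> S \<Longrightarrow> flat_at F u x"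
    and steep: "\<And>x. x \<in> S \<Longrightarrow> steep_at F v x"
  obtains M where "M \<in> lmeasurable" "S \<subseteq> M" "v * measure lebesgue M \<le> u * measure lebesgue U"
proof -
  have cov: "\<exists>s t. s \<le> x \<and> x \<le> t \<and> s < t \<and> t - s < d \<and> ({s..t} \<subseteq> U \<and> F t - F s \<le> u * (t - s))"
    if "x \<in> S" "0 < d" for x d
  proof -
    obtain e where e: "0 < e" "ball x e \<subseteq> U" using U(1) S \<open>x \<in> S\<close> by (meson open_contains_ball subsetD)
    then have "0 < min d e" using that by auto
    then obtain s t where st: "s \<le> x" "x \<le> t" "s < t" "t - s < min d e" "F t - F s \<le> u * (t - s)"
      using flat[OF \<open>x \<in> S\<close>] unfolding flat_at_def by blast
    then have "{s..t} \<subseteq> ball x e" by (auto simp: dist_real_def)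
    then have "{s..t} \<subseteq> U" using e by blast
    then show ?thesis using st by (intro exI[of _ s] exI[of _ t]) auto
  qed
  obtain I :: "(real \<times> real) set" where I: "countable I"
    "\<And>i. i \<in> I \<Longrightarrow> fst i < snd i \<and> ({fst i..snd i} \<subseteq> U \<and> F (snd i) - F (fst i) \<le> u * (snd i - fst i))"
    "pairwise (\<lambda>i j. disjnt {fst i..snd i} {fst j..snd j}) I"
    "negligible (S - (\<Union>i\<in>I. {fst i..snd i}))"
  proof (rule Vitali_covering_intervals[of S "\<lambda>s t. {s..t} \<subseteq> U \<and> F t - F s \<le> u * (t - s)"])
    show "\<exists>s t. s \<le> x \<and> x \<le> t \<and> s < t \<and> t - s < d \<and> ({s..t} \<subseteq> U \<and> F t - F s \<le> u * (t - s))"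
      if "x \<in> S" "0 < d" for x d using that by (rule cov)
  qed (rule that)
  have "\<exists>M. M \<in> lmeasurable \<and> S \<inter> {fst i<..<snd i} \<subseteq> M \<and> v * measure lebesgue M \<le> F (snd i) - F (fst i)"
    if "i \<in> I" for i
  proof -
    have "fst i \<le> snd i" using I(2)[OF that] by simp
    from mono_steep_set_measure_le[OF F \<open>0 < v\<close> this, of "S \<inter> {fst i<..<snd i}"] steep
    show ?thesis by (metis IntD1 Int_lower2)
  qed
  then obtain M where M: "\<And>i. i \<in> I \<Longrightarrow> M i \<in> lmeasurable"
      "\<And>i. i \<in> I \<Longrightarrow> S \<inter> {fst i<..<snd i} \<subseteq> M i"
      "\<And>i. i \<in> I \<Longrightarrow> v * measure lebesgue (M i) \<le> F (snd i) - F (fst i)"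
    by metis
  have fin: "measure lebesgue (\<Union>i\<in>I'. M i) \<le> u * measure lebesgue U / v" if "I' \<subseteq> I" "finite I'" for I'
  proof -
    have "v * measure lebesgue (\<Union>i\<in>I'. M i) \<le> v * (\<Sum>i\<in>I'. measure lebesgue (M i))"
      using \<open>0 < v\<close> that M(1) by (intro mult_left_mono measure_UNION_le) (auto simp: fmeasurableD)
    also have "\<dots> = (\<Sum>i\<in>I'. v * measure lebesgue (M i))" by (simp add: sum_distrib_left)
    also have "\<dots> \<le> (\<Sum>i\<in>I'. u * measure lebesgue {fst i..snd i})"
    proof (rule sum_mono)
      fix i assume "i \<in> I'"
      then have "i \<in> I" using that by auto
      from M(3)[OF this] I(2)[OF this]
      show "v * measure lebesgue (M i) \<le> u * measure lebesgue {fst i..snd i}" by simp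
    qed
    also have "\<dots> = u * measure lebesgue (\<Union>i\<in>I'. {fst i..snd i})"
      unfolding sum_distrib_left[symmetric]
      by (subst measure_UNION'[OF \<open>finite I'\<close>]) (auto intro: pairwise_subset[OF I(3) \<open>I' \<subseteq> I\<close>])
    also have "\<dots> \<le> u * measure lebesgue U"
      using I(2) that U(2) \<open>0 \<le> u\<close>
      by (intro mult_left_mono measure_mono_fmeasurable) (auto intro!: sets.finite_UN)
    finally show ?thesis using \<open>0 < v\<close> by (simp add: field_simps)
  qed
  \<comment> \<open>The inner covers live in the open intervals, so their end points have to be added.\<close>
  define N where "N = (S - (\<Union>i\<in>I. {fst i..snd i})) \<union> (\<Union>i\<in>I. {fst i, snd i})"
  have "negligible (\<Union>i\<in>I. {fst i, snd i})"
    using I(1) by (intro negligible_countable_Union) auto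
  then have N: "negligible N" unfolding N_def using I(4) by (rule negligible_Un[rotated])
  have U': "(\<Union>i\<in>I. M i) \<in> lmeasurable" "measure lebesgue (\<Union>i\<in>I. M i) \<le> u * measure lebesgue U / v"
    by (rule fmeasurable_UN_bound[OF I(1) _ fin] measure_UN_bound[OF I(1) _ fin]; simp add: M)+
  show thesis
  proof
    show "(\<Union>i\<in>I. M i) \<union> N \<in> lmeasurable"
      using fmeasurable.Un[OF U'(1) negligible_imp_measurable[OF N]] .
    show "S \<subseteq> (\<Union>i\<in>I. M i) \<union> N"
    proof
      fix x assume "x \<in> S"
      show "x \<in> (\<Union>i\<in>I. M i) \<union> N"
      proof (cases "\<exists>i\<in>I. x \<in> {fst i<..<snd i}")
        case True
        then show ?thesis using M(2) \<open>x \<in> S\<close> by blast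
      next
        case False
        then show ?thesis using \<open>x \<in> S\<close> unfolding N_def
          by simp (metis atLeastAtMost_iff greaterThanLessThan_iff order_le_less)
      qed
    qed
    have "measure lebesgue ((\<Union>i\<in>I. M i) \<union> N) \<le> measure lebesgue (\<Union>i\<in>I. M i) + measure lebesgue N"
      using U'(1) N by (intro measure_Un_le) (auto dest: fmeasurableD negligible_imp_sets)
    also have "\<dots> \<le> u * measure lebesgue U / v" using U'(2) N by (simp add: negligible_imp_measure0)
    finally show "v * measure lebesgue ((\<Union>i\<in>I. M i) \<union> N) \<le> u * measure lebesgue U"
      using \<open>0 < v\<close> by (simp only: pos_le_divide_eq mult.commute)
  qed
qed

text \<open>
  The infimum \<open>m\<close> of the measures of the supersets of \<open>S\<close> (its outer measure) satisfies
  \<open>v m \<le> u m\<close> by the preceding lemma applied to nearly optimal open supersets, so it vanishes.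
\<close>

lemma mono_oscillating_slope_negligible:
  fixes F :: "real \<Rightarrow> real"
  assumes F: "mono F" and "0 \<le> u" "u < v" and S: "S \<subseteq> {A<..<B}"
    and flat: "\<And>x. x \<in> S \<Longrightarrow> flat_at F u x"
    and steep: "\<And>x. x \<in> S \<Longrightarrow> steep_at F v x"
  shows "negligible S"
proof -
  define Q where "Q = measure lebesgue ` {M. S \<subseteq> M \<and> M \<in> lmeasurable}"
  define m where "m = Inf Q"
  have "{A<..<B} \<in> lmeasurable" by simp
  then have Q: "Q \<noteq> {}" "bdd_below Q"
    using S by (auto simp: Q_def intro!: bdd_belowI2[where m = 0])
  have m0: "0 \<le> m" unfolding m_def using Q(1) by (intro cInf_greatest) (auto simp: Q_def)
  have step: "v * m \<le> u * (m + e)" if "0 < e" for e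
  proof -
    have "Inf Q < m + e/2" using that by (simp add: m_def)
    then obtain T where T: "S \<subseteq> T" "T \<in> lmeasurable" "measure lebesgue T < m + e/2"
      unfolding Q_def[symmetric] using cInf_lessD[OF Q(1)] by (auto simp: Q_def)
    obtain U where U: "open U" "T \<subseteq> U" "U - T \<in> lmeasurable" "emeasure lebesgue (U - T) < ennreal (e/2)"
      using sets_lebesgue_outer_open[of T "e/2"] T(2) \<open>0 < e\<close> by (metis fmeasurableD half_gt_zero)
    have "U = T \<union> (U - T)" using U by auto
    then have Ul: "U \<in> lmeasurable" using T(2) U(3) by (metis fmeasurable.Un)
    have "measure lebesgue (U - T) < e/2"
      using U(3,4) that by (simp add: emeasure_eq_measure2 ennreal_less_iff)
    moreover have "measure lebesgue U \<le> measure lebesgue T + measure lebesgue (U - T)"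
      using \<open>U = _\<close> measure_Un_le[of T lebesgue "U - T"] T(2) U(3) by (simp add: fmeasurableD)
    ultimately have Um: "measure lebesgue U \<le> m + e" using T(3) by simp
    have "S \<subseteq> U" using T U by auto
    then obtain M where M: "M \<in> lmeasurable" "S \<subseteq> M" "v * measure lebesgue M \<le> u * measure lebesgue U"
      using mono_oscillating_slope_measure_le[OF F \<open>0 \<le> u\<close> _ U(1) Ul _ flat steep] \<open>0 \<le> u\<close> \<open>u < v\<close>
      by (metis order_le_less_trans)
    have "m \<le> measure lebesgue M" unfolding m_def using M Q(2) by (intro cInf_lower) (auto simp: Q_def)
    then have "v * m \<le> v * measure lebesgue M" using \<open>0 \<le> u\<close> \<open>u < v\<close> by (intro mult_left_mono) auto
    also have "\<dots> \<le> u * measure lebesgue U" by (rule M)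
    also have "\<dots> \<le> u * (m + e)" using Um \<open>0 \<le> u\<close> by (rule mult_left_mono)
    finally show ?thesis .
  qed
  have "v * m \<le> u * m"
  proof (rule field_le_epsilon)
    fix e :: real assume "0 < e"
    then have "0 < e / (u + 1)" using \<open>0 \<le> u\<close> by simp
    from step[OF this] have "v * m \<le> u * m + u * (e / (u + 1))" by (simp add: algebra_simps)
    also have "u * (e / (u + 1)) \<le> e" using \<open>0 \<le> u\<close> \<open>0 < e\<close> by (simp add: field_simps)
    finally show "v * m \<le> u * m + e" by simp
  qed
  then have "m = 0" using m0 \<open>u < v\<close> by (metis mult_right_mono order_antisym mult_less_cancel_right not_le order_le_less)
  show ?thesis
    unfolding negligible_outer
  proof (intro allI impI)
    fix e :: real assume "0 < e"
    then have "Inf Q < e" using \<open>m = 0\<close> by (simp add: m_def)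
    then show "\<exists>T. S \<subseteq> T \<and> T \<in> lmeasurable \<and> measure lebesgue T < e"
      using cInf_lessD[OF Q(1)] by (auto simp: Q_def)
  qed
qed

lemma mono_infinite_slope_negligible:
  fixes F :: "real \<Rightarrow> real"
  assumes F: "mono F" and S: "S \<subseteq> {A<..<B}"
    and steep: "\<And>x K. \<lbrakk>x \<in> S; 0 < K\<rbrakk> \<Longrightarrow> steep_at F K x"
  shows "negligible S"
proof (cases "A < B")
  case True
  show ?thesis
    unfolding negligible_outer_le
  proof (intro allI impI)
    fix e :: real assume "0 < e"
    define K where "K = (F B - F A + 1) / e"
    have FF: "F A \<le> F B" using F True by (simp add: monoD)
    then have "0 < K" using \<open>0 < e\<close> by (simp add: K_def)
    from mono_steep_set_measure_le[OF F this _ S steep[OF _ this]] True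
    obtain M where M: "M \<in> lmeasurable" "S \<subseteq> M" "K * measure lebesgue M \<le> F B - F A" by auto
    then have "K * measure lebesgue M \<le> K * e" using \<open>0 < e\<close> by (simp add: K_def)
    then have "measure lebesgue M \<le> e" using \<open>0 < K\<close> by simp
    then show "\<exists>T. S \<subseteq> T \<and> T \<in> lmeasurable \<and> measure lebesgue T \<le> e" using M by blast
  qed
qed (use S in auto)

lemma not_flat_atE:
  assumes "\<not> flat_at F u x"
  obtains d where "d > 0" "\<And>s t. \<lbrakk>s \<le> x; x \<le> t; s < t; t - s < d\<rbrakk> \<Longrightarrow> u * (t - s) < F t - F s"
proof -
  have "\<exists>d>0. \<forall>s t. s \<le> x \<longrightarrow> x \<le> t \<longrightarrow> s < t \<longrightarrow> t - s < d \<longrightarrow> u * (t - s) < F t - F s"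
    using assms unfolding flat_at_def by (meson not_le)
  then show thesis using that by blast
qed

lemma not_steep_atE:
  assumes "\<not> steep_at F v x"
  obtains d where "d > 0" "\<And>s t. \<lbrakk>s \<le> x; x \<le> t; s < t; t - s < d\<rbrakk> \<Longrightarrow> F t - F s < v * (t - s)"
proof -
  have "\<exists>d>0. \<forall>s t. s \<le> x \<longrightarrow> x \<le> t \<longrightarrow> s < t \<longrightarrow> t - s < d \<longrightarrow> F t - F s < v * (t - s)"
    using assms unfolding steep_at_def by (meson not_le)
  then show thesis using that by blast
qed

text \<open>
  The derivative is the supremum of the slopes that all sufficiently short difference quotients
  around \<open>x\<close> exceed.  If no rational gap separates a flat from a steep slope, all short difference
  quotients are squeezed around this supremum.
\<close>

lemma differentiable_if_no_oscillation:
  fixes F :: "real \<Rightarrow> real"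
  assumes F: "mono F"
    and fin: "\<not> steep_at F K x"
    and osc: "\<And>u v. \<lbrakk>u \<in> \<rat>; v \<in> \<rat>; 0 \<le> u; u < v; flat_at F u x\<rbrakk> \<Longrightarrow> \<not> steep_at F v x"
  shows "F differentiable (at x)"
proof -
  define A where "A = {u. \<not> flat_at F u x}"
  have low: "u < w" if u: "\<not> flat_at F u x" and w: "\<not> steep_at F w x" for u w
  proof -
    obtain d1 where d1: "d1 > 0" "\<And>s t. \<lbrakk>s \<le> x; x \<le> t; s < t; t - s < d1\<rbrakk> \<Longrightarrow> u * (t - s) < F t - F s"
      using not_flat_atE[OF u] by blast
    obtain d2 where d2: "d2 > 0" "\<And>s t. \<lbrakk>s \<le> x; x \<le> t; s < t; t - s < d2\<rbrakk> \<Longrightarrow> F t - F s < w * (t - s)"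
      using not_steep_atE[OF w] by blast
    define h where "h = min d1 d2 / 2"
    have h: "0 < h" "h < d1" "h < d2" using d1 d2 by (auto simp: h_def)
    have "u * h < F (x + h) - F x" "F (x + h) - F x < w * h"
      using d1(2)[of x "x + h"] d2(2)[of x "x + h"] h by auto
    then have "u * h < w * h" by (rule order_less_trans)
    then show ?thesis using h(1) mult_less_cancel_right_pos by blast
  qed
  have mem: "u \<in> A" if "u < 0" for u
  proof -
    have *: "u * (t - s) < F t - F s" if "s < t" for s t
    proof -
      have "u * (t - s) < 0" using \<open>u < 0\<close> that by (simp add: mult_neg_pos)
      moreover have "F s \<le> F t" using F that by (simp add: monoD)
      ultimately show ?thesis by simp
    qed
    then show ?thesis unfolding A_def flat_at_def
      by (simp add: not_le) (intro exI[of _ 1] conjI allI impI disjI2 *; simp)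
  qed
  have bdd: "bdd_above A" using low[OF _ fin] by (auto simp: A_def intro!: bdd_aboveI[of _ K] less_imp_le)
  have ne: "A \<noteq> {}" using mem[of "-1"] by auto
  define D where "D = Sup A"
  have D0: "0 \<le> D"
  proof (rule dense_le)
    show "u \<le> D" if "u < 0" for u
      unfolding D_def using mem[OF that] bdd by (rule cSup_upper)
  qed
  have "(F has_derivative (\<lambda>h. h * D)) (at x)"
    unfolding has_derivative_at_alt
  proof (intro conjI allI impI)
    show "bounded_linear (\<lambda>h. h * D)" by (rule bounded_linear_mult_left)
    fix e :: real assume "0 < e"
    have "D - e < Sup A" using \<open>0 < e\<close> by (simp add: D_def)
    then obtain u where u: "u \<in> A" "D - e < u" using less_cSupD[OF ne] by blast
    then obtain d1 where d1: "d1 > 0" "\<And>s t. \<lbrakk>s \<le> x; x \<le> t; s < t; t - s < d1\<rbrakk> \<Longrightarrow> u * (t - s) < F t - F s"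
      unfolding A_def using not_flat_atE by blast
    obtain p where p: "p \<in> \<rat>" "D < p" "p < D + e" using Rats_dense_in_real[of D "D + e"] \<open>0 < e\<close> by auto
    obtain q where q: "q \<in> \<rat>" "p < q" "q < D + e" using Rats_dense_in_real[of p "D + e"] p by auto
    have "p \<notin> A" using p(2) cSup_upper[OF _ bdd] unfolding D_def by force
    then have "\<not> steep_at F q x" using osc[OF p(1) q(1) _ q(2)] p D0 by (auto simp: A_def)
    then obtain d2 where d2: "d2 > 0" "\<And>s t. \<lbrakk>s \<le> x; x \<le> t; s < t; t - s < d2\<rbrakk> \<Longrightarrow> F t - F s < q * (t - s)"
      using not_steep_atE by blast
    have two: "\<bar>F t - F s - D * (t - s)\<bar> \<le> e * (t - s)" if st: "s \<le> x" "x \<le> t" "s < t" "t - s < min d1 d2" for s t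
    proof -
      have "(D - e) * (t - s) \<le> u * (t - s)" "q * (t - s) \<le> (D + e) * (t - s)"
        using u q st by (auto intro!: mult_right_mono)
      moreover have "u * (t - s) < F t - F s" "F t - F s < q * (t - s)" using d1(2) d2(2) st by auto
      ultimately show ?thesis by (simp add: abs_le_iff algebra_simps)
    qed
    have "norm (F y - F x - (y - x) * D) \<le> e * norm (y - x)" if y: "norm (y - x) < min d1 d2" for y
    proof -
      consider "y < x" | "y = x" | "x < y" by linarith
      then show ?thesis
      proof cases
        case 1
        then show ?thesis using two[of y x] y by (simp add: abs_le_iff algebra_simps)
      next
        case 3
        then show ?thesis using two[of x y] y by (simp add: abs_le_iff algebra_simps)
      qed simp
    qed
    then show "\<exists>d>0. \<forall>y. norm (y - x) < d \<longrightarrow> norm (F y - F x - (y - x) * D) \<le> e * norm (y - x)"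
      using d1(1) d2(1) by (intro exI[of _ "min d1 d2"]) auto
  qed
  then show ?thesis by (auto simp: differentiable_def)
qed

text \<open>
  \<^emph>\<open>Lebesgue's theorem on monotone functions.\<close>  A point where \<open>F\<close> is not differentiable has either
  unbounded difference quotients or difference quotients oscillating across a gap between two
  nonnegative rationals; both kinds of points form null sets in every bounded interval.
\<close>

theorem mono_differentiable_almost_everywhere:
  fixes F :: "real \<Rightarrow> real"
  assumes F: "mono F"
  shows "negligible {x. \<not> F differentiable (at x)}"
proof -
  define J where "J n = {- real n<..<real n}" for n
  define S1 where "S1 n = {x \<in> J n. \<forall>K>0. steep_at F K x}" for n
  define S2 where "S2 p n = {x \<in> J n. flat_at F (fst p) x \<and> steep_at F (snd p) x}" for p :: "real \<times> real" and n
  define R where "R = {p \<in> (\<rat> :: real set) \<times> \<rat>. 0 \<le> fst p \<and> fst p < snd p}"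
  have 1: "negligible (S1 n)" for n
    by (rule mono_infinite_slope_negligible[OF F, of _ "- real n" "real n"])
       (auto simp: S1_def J_def)
  have 2: "negligible (S2 p n)" if "p \<in> R" for p n
    by (rule mono_oscillating_slope_negligible[OF F, of "fst p" "snd p" _ "- real n" "real n"])
       (use that in \<open>auto simp: S2_def J_def R_def\<close>)
  have "countable R"
    unfolding R_def by (rule countable_subset[of _ "\<rat> \<times> \<rat>"]) (auto simp: countable_rat)
  then have "negligible ((\<Union>n. S1 n) \<union> (\<Union>n. \<Union>p\<in>R. S2 p n))"
    using 1 2 by (intro negligible_Un negligible_countable_Union) auto
  then show ?thesis
  proof (rule negligible_subset, safe)
    fix x assume nd: "\<not> F differentiable (at x)" and x: "x \<notin> (\<Union>n. \<Union>p\<in>R. S2 p n)"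
    obtain n where "\<bar>x\<bar> < real n" using reals_Archimedean2 by blast
    then have n: "x \<in> J n" by (auto simp: J_def)
    have "\<not> steep_at F v x" if "u \<in> \<rat>" "v \<in> \<rat>" "0 \<le> u" "u < v" "flat_at F u x" for u v
    proof -
      have "(u, v) \<in> R" using that by (simp add: R_def)
      then show ?thesis using x n that by (auto simp: S2_def)
    qed
    then have "steep_at F K x" for K
      using differentiable_if_no_oscillation[OF F] nd by blast
    then show "x \<in> (\<Union>n. S1 n)" using n by (auto simp: S1_def)
  qed
qed

section \<open>Absolutely continuous functions of a real variable\<close>

definition interval_family :: "real set \<Rightarrow> 'i set \<Rightarrow> ('i \<Rightarrow> real) \<Rightarrow> ('i \<Rightarrow> real) \<Rightarrow> bool" where
  "interval_family S I \<alpha> \<beta> \<longleftrightarrow> finite I \<and> (\<forall>i\<in>I. \<alpha> i \<le> \<beta> i \<and> {\<alpha> i..\<beta> i} \<subseteq> S) \<and>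
     (\<forall>i\<in>I. \<forall>j\<in>I. i \<noteq> j \<longrightarrow> {\<alpha> i<..<\<beta> i} \<inter> {\<alpha> j<..<\<beta> j} = {})"

lemma interval_family_length_le_measure:
  assumes fam: "interval_family S I \<alpha> \<beta>"
    and sub: "\<And>i. i \<in> I \<Longrightarrow> {\<alpha> i<..<\<beta> i} \<subseteq> M" and M: "M \<in> lmeasurable"
  shows "(\<Sum>i\<in>I. \<beta> i - \<alpha> i) \<le> measure lebesgue M"
proof -
  have "(\<Sum>i\<in>I. \<beta> i - \<alpha> i) = (\<Sum>i\<in>I. measure lebesgue {\<alpha> i<..<\<beta> i})"
    using fam by (intro sum.cong) (auto simp: interval_family_def)
  also have "\<dots> = measure lebesgue (\<Union>i\<in>I. {\<alpha> i<..<\<beta> i})"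
    by (rule measure_UNION'[symmetric])
       (use fam in \<open>auto simp: interval_family_def pairwise_def disjnt_def\<close>)
  also have "\<dots> \<le> measure lebesgue M"
    using fam sub M by (intro measure_mono_fmeasurable) (auto simp: interval_family_def)
  finally show ?thesis .
qed

lemma abs_continuous_on_subset:
  assumes "abs_continuous_on S f" "T \<subseteq> S"
  shows "abs_continuous_on T f"
  using assms unfolding abs_continuous_on_def by (meson subset_trans)

text \<open>
  The index set is arbitrary here, so that the families can be read off directly from divisions
  and tagged divisions.
\<close>

lemma abs_continuous_onE_family:
  fixes f :: "real \<Rightarrow> 'a::real_normed_vector"
  assumes "abs_continuous_on S f" "0 < \<epsilon>"
  obtains \<delta> where "0 < \<delta>"
    "\<And>(I::'i set) \<alpha> \<beta>. \<lbrakk>interval_family S I \<alpha> \<beta>; (\<Sum>i\<in>I. \<beta> i - \<alpha> i) < \<delta>\<rbrakk>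
     \<Longrightarrow> (\<Sum>i\<in>I. norm (f (\<beta> i) - f (\<alpha> i))) < \<epsilon>"
proof -
  have "\<exists>\<delta>>0. \<forall>(n::nat) (\<alpha>::nat \<Rightarrow> real) (\<beta>::nat \<Rightarrow> real).
        (\<forall>k<n. \<alpha> k \<le> \<beta> k \<and> {\<alpha> k..\<beta> k} \<subseteq> S) \<and>
        disjoint_family_on (\<lambda>k. {\<alpha> k<..<\<beta> k}) {..<n} \<and> (\<Sum>k<n. \<beta> k - \<alpha> k) < \<delta>
        \<longrightarrow> (\<Sum>k<n. norm (f (\<beta> k) - f (\<alpha> k))) < \<epsilon>"
    using assms unfolding abs_continuous_on_def by simp
  then obtain \<delta> where \<delta>: "0 < \<delta>" and ac: "\<forall>(n::nat) (\<alpha>::nat \<Rightarrow> real) (\<beta>::nat \<Rightarrow> real).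
        (\<forall>k<n. \<alpha> k \<le> \<beta> k \<and> {\<alpha> k..\<beta> k} \<subseteq> S) \<and>
        disjoint_family_on (\<lambda>k. {\<alpha> k<..<\<beta> k}) {..<n} \<and> (\<Sum>k<n. \<beta> k - \<alpha> k) < \<delta>
        \<longrightarrow> (\<Sum>k<n. norm (f (\<beta> k) - f (\<alpha> k))) < \<epsilon>"
    by (elim exE conjE)
  show thesis
  proof (rule that[OF \<delta>])
    fix I :: "'i set" and \<alpha> \<beta> :: "'i \<Rightarrow> real"
    assume fam: "interval_family S I \<alpha> \<beta>" and len: "(\<Sum>i\<in>I. \<beta> i - \<alpha> i) < \<delta>"
    have I: "finite I" using fam by (simp add: interval_family_def)
    obtain h where h: "bij_betw h {..<card I} I"
      using ex_bij_betw_nat_finite[OF I] by (auto simp: atLeast0LessThan)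
    have hI: "h k \<in> I" if "k < card I" for k using h that by (auto simp: bij_betw_def)
    have "(\<Sum>k<card I. norm (f (\<beta> (h k)) - f (\<alpha> (h k)))) < \<epsilon>"
    proof (rule ac[THEN spec, THEN spec, THEN spec, THEN mp], intro conjI)
      show "\<forall>k<card I. \<alpha> (h k) \<le> \<beta> (h k) \<and> {\<alpha> (h k)..\<beta> (h k)} \<subseteq> S"
        using hI fam by (auto simp: interval_family_def)
      show "disjoint_family_on (\<lambda>k. {\<alpha> (h k)<..<\<beta> (h k)}) {..<card I}"
        unfolding disjoint_family_on_def
      proof (intro ballI impI)
        fix k l assume "k \<in> {..<card I}" "l \<in> {..<card I}" "k \<noteq> l"
        then have "h k \<in> I" "h l \<in> I" "h k \<noteq> h l" using h hI by (auto simp: bij_betw_def inj_on_def)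
        then show "{\<alpha> (h k)<..<\<beta> (h k)} \<inter> {\<alpha> (h l)<..<\<beta> (h l)} = {}"
          using fam unfolding interval_family_def by blast
      qed
      show "(\<Sum>k<card I. \<beta> (h k) - \<alpha> (h k)) < \<delta>"
        using len sum.reindex_bij_betw[OF h, of "\<lambda>i. \<beta> i - \<alpha> i"] by simp
    qed
    then show "(\<Sum>i\<in>I. norm (f (\<beta> i) - f (\<alpha> i))) < \<epsilon>"
      using sum.reindex_bij_betw[OF h, of "\<lambda>i. norm (f (\<beta> i) - f (\<alpha> i))"] by simp
  qed
qed

lemma negligible_open_superset:
  assumes "negligible (E :: real set)" "0 < (\<delta>::real)"
  obtains U where "open U" "E \<subseteq> U" "U \<in> lmeasurable" "measure lebesgue U < \<delta>"
proof -
  obtain U where U: "open U" "E \<subseteq> U" "U - E \<in> lmeasurable" "emeasure lebesgue (U - E) < ennreal \<delta>"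
    using sets_lebesgue_outer_open[of E \<delta>] assms by (auto dest: negligible_imp_sets)
  have "U = E \<union> (U - E)" using U by auto
  then have Ul: "U \<in> lmeasurable" using U(3) assms by (metis fmeasurable.Un negligible_imp_measurable)
  have "measure lebesgue (U - E) < \<delta>"
    using U(3,4) assms by (simp add: emeasure_eq_measure2 ennreal_less_iff)
  moreover have "measure lebesgue U \<le> measure lebesgue E + measure lebesgue (U - E)"
    using \<open>U = _\<close> measure_Un_le[of E lebesgue "U - E"] U(3) assms by (simp add: fmeasurableD negligible_imp_sets)
  ultimately show thesis using that U Ul assms by (simp add: negligible_imp_measure0)
qed

text \<open>
  In a Riemann sum over a sufficiently fine tagged division, the tags outside \<open>E\<close> are handled by the
  straddle estimate as for everywhere differentiable functions.  The intervals with tag in \<open>E\<close> lie in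
  an open set of small measure, and absolute continuity makes the sum of the increments of \<open>f\<close> over
  them small.
\<close>

lemma abs_continuous_has_integral_derivative:
  fixes f :: "real \<Rightarrow> 'a::banach"
  assumes "a \<le> b" and ac: "abs_continuous_on {a..b} f" and E: "negligible E"
    and der: "\<And>x. \<lbrakk>x \<in> {a..b}; x \<notin> E\<rbrakk> \<Longrightarrow> (f has_vector_derivative f' x) (at x within {a..b})"
  shows "((\<lambda>x. if x \<in> E then 0 else f' x) has_integral (f b - f a)) {a..b}"
  unfolding has_integral_real
proof (intro allI impI)
  fix \<epsilon> :: real assume "0 < \<epsilon>"
  \<comment> \<open>The slack \<open>+ 1\<close> keeps the denominator positive when \<open>a = b\<close>.\<close>
  define e where "e = \<epsilon> / (2 * (b - a + 1))"
  have e: "0 < e" "e * (b - a) < \<epsilon> / 2"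
    using \<open>0 < \<epsilon>\<close> \<open>a \<le> b\<close> by (auto simp: e_def field_simps)
  obtain \<delta> where \<delta>: "0 < \<delta>" and small:
    "\<And>(I::(real \<times> real set) set) \<alpha> \<beta>. \<lbrakk>interval_family {a..b} I \<alpha> \<beta>; (\<Sum>i\<in>I. \<beta> i - \<alpha> i) < \<delta>\<rbrakk>
     \<Longrightarrow> (\<Sum>i\<in>I. norm (f (\<beta> i) - f (\<alpha> i))) < \<epsilon> / 2"
    by (rule abs_continuous_onE_family[OF ac half_gt_zero[OF \<open>0 < \<epsilon>\<close>]]) (rule that)
  obtain U where U: "open U" "E \<subseteq> U" "U \<in> lmeasurable" "measure lebesgue U < \<delta>"
    using negligible_open_superset[OF E \<delta>] .
  have "\<exists>d>0. x \<in> {a..b} \<and> x \<notin> E \<longrightarrow>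
         (\<forall>y\<in>{a..b}. norm (y-x) < d \<longrightarrow> norm (f y - f x - (y-x) *\<^sub>R f' x) \<le> e * norm (y-x))" for x
  proof (cases "x \<in> {a..b} \<and> x \<notin> E")
    case True
    then show ?thesis
      using der[of x, unfolded has_vector_derivative_def has_derivative_within_alt] e(1) by blast
  qed (auto intro: exI[of _ 1])
  then obtain d where d: "\<And>x. 0 < d x"
     "\<And>x y. \<lbrakk>x \<in> {a..b}; x \<notin> E; y \<in> {a..b}; norm (y-x) < d x\<rbrakk>
        \<Longrightarrow> norm (f y - f x - (y-x) *\<^sub>R f' x) \<le> e * norm (y-x)"
    by metis
  define \<gamma> where "\<gamma> x = (if x \<in> E then U else ball x (d x))" for x
  show "\<exists>\<gamma>. gauge \<gamma> \<and> (\<forall>\<D>. \<D> tagged_division_of {a..b} \<and> \<gamma> fine \<D> \<longrightarrow>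
         norm ((\<Sum>(x,K)\<in>\<D>. measure lborel K *\<^sub>R (if x \<in> E then 0 else f' x)) - (f b - f a)) < \<epsilon>)"
  proof (intro exI[of _ \<gamma>] conjI allI impI; (elim conjE)?)
    show "gauge \<gamma>" using U d(1) by (auto simp: gauge_def \<gamma>_def)
    fix p assume p: "p tagged_division_of {a..b}" and fine: "\<gamma> fine p"
    have finp: "finite p" using p by blast
    have K: "\<exists>u v. u \<le> v \<and> K = {u..v} \<and> u \<le> x \<and> x \<le> v \<and> a \<le> u \<and> v \<le> b" if xK: "(x, K) \<in> p" for x K
    proof -
      have "x \<in> K" "K \<subseteq> {a..b}" using p xK by blast+
      moreover obtain u v where "K = cbox u v" using tagged_division_ofD(4)[OF p xK] by blast
      ultimately show ?thesis by (intro exI[of _ u] exI[of _ v]) auto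
    qed
    define T where "T xK = measure lborel (snd xK) *\<^sub>R (if fst xK \<in> E then 0 else f' (fst xK))
       - (f (Sup (snd xK)) - f (Inf (snd xK)))" for xK :: "real \<times> real set"
    define p1 where "p1 = {xK \<in> p. fst xK \<in> E}"
    define p2 where "p2 = {xK \<in> p. fst xK \<notin> E}"
    have p12: "p = p1 \<union> p2" "p1 \<inter> p2 = {}" "finite p1" "finite p2"
      using finp by (auto simp: p1_def p2_def)
    have "(\<Sum>(x,K)\<in>p. measure lborel K *\<^sub>R (if x \<in> E then 0 else f' x)) - (f b - f a) = (\<Sum>xK\<in>p. T xK)"
      using additive_tagged_division_1[OF \<open>a \<le> b\<close> p, of f]
      by (simp add: T_def sum_subtractf case_prod_unfold)
    also have "\<dots> = (\<Sum>xK\<in>p1. T xK) + (\<Sum>xK\<in>p2. T xK)"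
      using p12 by (simp add: sum.union_disjoint)
    finally have split: "norm ((\<Sum>(x,K)\<in>p. measure lborel K *\<^sub>R (if x \<in> E then 0 else f' x)) - (f b - f a))
        \<le> norm (\<Sum>xK\<in>p1. T xK) + norm (\<Sum>xK\<in>p2. T xK)"
      by (simp add: norm_triangle_ineq)
    have "norm (\<Sum>xK\<in>p1. T xK) \<le> (\<Sum>xK\<in>p1. norm (f (Sup (snd xK)) - f (Inf (snd xK))))"
      by (rule sum_norm_le) (auto simp: T_def p1_def norm_minus_commute)
    also have "\<dots> < \<epsilon> / 2"
    proof (rule small)
      have io: "interior (snd i) = {Inf (snd i)<..<Sup (snd i)}" if "i \<in> p" for i
        using K[of "fst i" "snd i"] that by auto
      show fam: "interval_family {a..b} p1 (\<lambda>i. Inf (snd i)) (\<lambda>i. Sup (snd i))"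
        unfolding interval_family_def
      proof (intro conjI ballI impI)
        fix i j assume ij: "i \<in> p1" "j \<in> p1" "i \<noteq> j"
        then have "i \<in> p" "j \<in> p" by (auto simp: p1_def)
        then have "interior (snd i) \<inter> interior (snd j) = {}"
          using tagged_division_ofD(5)[OF p, of "fst i" "snd i" "fst j" "snd j"] ij by auto
        then show "{Inf (snd i)<..<Sup (snd i)} \<inter> {Inf (snd j)<..<Sup (snd j)} = {}"
          using io \<open>i \<in> p\<close> \<open>j \<in> p\<close> by simp
      next
        fix i assume "i \<in> p1"
        then show "Inf (snd i) \<le> Sup (snd i)" "{Inf (snd i)..Sup (snd i)} \<subseteq> {a..b}"
          using K[of "fst i" "snd i"] by (auto simp: p1_def)
      qed (rule p12)
      have "{Inf (snd i)<..<Sup (snd i)} \<subseteq> U" if "i \<in> p1" for i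
      proof -
        have "(fst i, snd i) \<in> p" "fst i \<in> E" using that by (auto simp: p1_def)
        have "snd i \<subseteq> \<gamma> (fst i)" by (rule fineD[OF fine \<open>(fst i, snd i) \<in> p\<close>])
        then have "snd i \<subseteq> U" using \<open>fst i \<in> E\<close> by (simp only: \<gamma>_def if_True)
        moreover obtain u v where "u \<le> v" "snd i = {u..v}"
          using K[OF \<open>(fst i, snd i) \<in> p\<close>] by blast
        then have "{Inf (snd i)<..<Sup (snd i)} \<subseteq> snd i"
          by (simp add: greaterThanLessThan_subseteq_atLeastAtMost_iff)
        ultimately show ?thesis by blast
      qed
      from interval_family_length_le_measure[OF fam this U(3)]
      show "(\<Sum>i\<in>p1. Sup (snd i) - Inf (snd i)) < \<delta>" using U(4) by simp
    qed
    finally have 1: "norm (\<Sum>xK\<in>p1. T xK) < \<epsilon> / 2" .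
    have "norm (\<Sum>xK\<in>p2. T xK) \<le> (\<Sum>xK\<in>p2. e * (Sup (snd xK) - Inf (snd xK)))"
    proof (rule sum_norm_le)
      fix i assume i: "i \<in> p2"
      define x where "x = fst i"
      have ip: "(x, snd i) \<in> p" and xE: "x \<notin> E" using i by (auto simp: p2_def x_def)
      obtain u v where uv: "u \<le> v" "snd i = {u..v}" "u \<le> x" "x \<le> v" "a \<le> u" "v \<le> b"
        using K[OF ip] by blast
      have "snd i \<subseteq> ball x (d x)" using fineD[OF fine ip] xE by (simp add: \<gamma>_def)
      moreover have "u \<in> snd i" "v \<in> snd i" using uv by auto
      ultimately have "u \<in> ball x (d x)" "v \<in> ball x (d x)" by blast+
      then have n: "norm (u - x) < d x" "norm (v - x) < d x"
        by (simp_all add: dist_norm norm_minus_commute)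
      have "norm (T i) = norm ((f u - f x - (u - x) *\<^sub>R f' x) - (f v - f x - (v - x) *\<^sub>R f' x))"
        using uv xE by (simp add: T_def x_def[symmetric] algebra_simps)
      also have "\<dots> \<le> norm (f u - f x - (u - x) *\<^sub>R f' x) + norm (f v - f x - (v - x) *\<^sub>R f' x)"
        by (rule norm_triangle_ineq4)
      also have "\<dots> \<le> e * norm (u - x) + e * norm (v - x)"
        using uv xE n by (intro add_mono d(2)) auto
      also have "\<dots> = e * (Sup (snd i) - Inf (snd i))"
        using uv by (simp add: algebra_simps)
      finally show "norm (T i) \<le> e * (Sup (snd i) - Inf (snd i))" .
    qed
    also have "\<dots> \<le> (\<Sum>xK\<in>p. e * (Sup (snd xK) - Inf (snd xK)))"
    proof (rule sum_mono2)
      fix i assume "i \<in> p - p2"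
      then show "0 \<le> e * (Sup (snd i) - Inf (snd i))"
        using K[of "fst i" "snd i"] e(1) by auto
    qed (use finp p12 in auto)
    also have "\<dots> = e * (b - a)"
      using additive_tagged_division_1[OF \<open>a \<le> b\<close> p, of "\<lambda>x. x"]
      by (simp add: sum_distrib_left[symmetric] case_prod_unfold)
    finally show "norm ((\<Sum>(x,K)\<in>p. measure lborel K *\<^sub>R (if x \<in> E then 0 else f' x)) - (f b - f a)) < \<epsilon>"
      using split 1 e(2) by linarith
  qed
qed

lemma interval_family_mono:
  "\<lbrakk>interval_family S I \<alpha> \<beta>; S \<subseteq> T\<rbrakk> \<Longrightarrow> interval_family T I \<alpha> \<beta>"
  unfolding interval_family_def by (metis subset_trans)

text \<open>
  Appending \<open>[x, y]\<close> to a family of intervals in \<open>[p, x]\<close> is what makes the variation superadditive.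
\<close>

lemma interval_family_snoc:
  fixes \<alpha> \<beta> :: "nat \<Rightarrow> real"
  assumes "interval_family {p..x} {..<n} \<alpha> \<beta>" "p \<le> x" "x \<le> y"
  shows "interval_family {p..y} {..<Suc n} (\<alpha>(n := x)) (\<beta>(n := y))"
proof -
  have fam: "\<alpha> k \<le> \<beta> k \<and> p \<le> \<alpha> k \<and> \<beta> k \<le> x" if "k < n" for k
    using assms(1) that by (simp add: interval_family_def)
  have disj: "{\<alpha> k<..<\<beta> k} \<inter> {\<alpha> l<..<\<beta> l} = {}" if "k < n" "l < n" "k \<noteq> l" for k l
    using assms(1) that unfolding interval_family_def by blast
  have last: "{\<alpha> k<..<\<beta> k} \<inter> {x<..<y} = {}" "{x<..<y} \<inter> {\<alpha> k<..<\<beta> k} = {}" if "k < n" for k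
    using fam[OF that] by auto
  show ?thesis
    unfolding interval_family_def
  proof (intro conjI ballI impI)
    fix k l assume kl: "k \<in> {..<Suc n}" "l \<in> {..<Suc n}" "k \<noteq> l"
    show "{(\<alpha>(n := x)) k<..<(\<beta>(n := y)) k} \<inter> {(\<alpha>(n := x)) l<..<(\<beta>(n := y)) l} = {}"
    proof (cases "k = n")
      case True
      then show ?thesis using kl last(2)[of l] by simp
    next
      case False
      then show ?thesis using kl last(1)[of k] disj[of k l] by (cases "l = n") simp_all
    qed
  next
    fix k assume "k \<in> {..<Suc n}"
    then have "(\<alpha>(n := x)) k \<le> (\<beta>(n := y)) k \<and> p \<le> (\<alpha>(n := x)) k \<and> (\<beta>(n := y)) k \<le> y"
      using fam[of k] assms(2,3) by (cases "k = n") auto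
    then show "(\<alpha>(n := x)) k \<le> (\<beta>(n := y)) k" "{(\<alpha>(n := x)) k..(\<beta>(n := y)) k} \<subseteq> {p..y}"
      by auto
  qed simp
qed

text \<open>
  The supremum of this set is the total variation of \<open>f\<close> on \<open>[p, x]\<close>.
\<close>

definition variation_sums :: "(real \<Rightarrow> real) \<Rightarrow> real \<Rightarrow> real \<Rightarrow> real set" where
  "variation_sums f p x =
     {\<Sum>k<n. \<bar>f (\<beta> k) - f (\<alpha> k)\<bar> | (n::nat) \<alpha> \<beta>. interval_family {p..x} {..<n} \<alpha> \<beta>}"

lemma variation_increment:
  assumes bdd: "bdd_above (variation_sums f p y)" and xy: "p \<le> x" "x \<le> y"
  shows "Sup (variation_sums f p x) + \<bar>f y - f x\<bar> \<le> Sup (variation_sums f p y)"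
proof -
  have "Sup (variation_sums f p x) \<le> Sup (variation_sums f p y) - \<bar>f y - f x\<bar>"
  proof (rule cSup_least)
    have "interval_family {p..x} {..<0::nat} (\<lambda>_. 0) (\<lambda>_. 0)" by (simp add: interval_family_def)
    then show "variation_sums f p x \<noteq> {}" unfolding variation_sums_def by blast
    fix w assume "w \<in> variation_sums f p x"
    then obtain n :: nat and \<alpha> \<beta> where fam: "interval_family {p..x} {..<n} \<alpha> \<beta>"
      and w: "w = (\<Sum>k<n. \<bar>f (\<beta> k) - f (\<alpha> k)\<bar>)" by (auto simp: variation_sums_def)
    have "w + \<bar>f y - f x\<bar> = (\<Sum>k<Suc n. \<bar>f ((\<beta>(n := y)) k) - f ((\<alpha>(n := x)) k)\<bar>)"
      by (simp add: w)
    then have "w + \<bar>f y - f x\<bar> \<in> variation_sums f p y"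
      unfolding variation_sums_def using interval_family_snoc[OF fam xy] by blast
    from cSup_upper[OF this bdd] show "w \<le> Sup (variation_sums f p y) - \<bar>f y - f x\<bar>" by simp
  qed
  then show ?thesis by simp
qed

text \<open>
  The Jordan decomposition: \<open>f\<close> is the difference of its variation function \<open>V\<close> and \<open>V - f\<close>, both of
  which are nondecreasing.  Clamping the argument to \<open>[p, q]\<close> makes them monotone on the whole line.
\<close>

lemma bounded_variation_differentiable_ae:
  fixes f :: "real \<Rightarrow> real"
  assumes bdd: "bdd_above (variation_sums f p q)"
  shows "negligible {x \<in> {p<..<q}. \<not> f differentiable (at x)}"
proof (cases "p < q")
  case True
  have bdd': "bdd_above (variation_sums f p y)" if "y \<le> q" for y
  proof (rule bdd_above_mono[OF bdd])
    show "variation_sums f p y \<subseteq> variation_sums f p q"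
      unfolding variation_sums_def
      using interval_family_mono[of "{p..y}" _ _ _ "{p..q}"] that by fastforce
  qed
  define cl where "cl x = max p (min q x)" for x
  have cl: "p \<le> cl x" "cl x \<le> q" for x using True by (auto simp: cl_def)
  have cl_mono: "cl x \<le> cl y" if "x \<le> y" for x y using that by (auto simp: cl_def)
  define V where "V x = Sup (variation_sums f p (cl x))" for x
  define G where "G x = V x - f (cl x)" for x
  have inc: "V x + \<bar>f (cl y) - f (cl x)\<bar> \<le> V y" if "x \<le> y" for x y
    unfolding V_def by (rule variation_increment) (use cl cl_mono that bdd' in auto)
  have "mono V" by (rule monoI) (use inc in force)
  moreover have "mono G" by (rule monoI) (use inc in \<open>force simp: G_def\<close>)
  ultimately have neg: "negligible ({x. \<not> V differentiable (at x)} \<union> {x. \<not> G differentiable (at x)})"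
    by (intro negligible_Un mono_differentiable_almost_everywhere)
  show ?thesis
  proof (rule negligible_subset[OF neg], safe)
    fix x assume x: "x \<in> {p<..<q}" and nd: "\<not> f differentiable (at x)" and G: "G differentiable (at x)"
      and V: "V differentiable (at x)"
    have "(\<lambda>x. V x - G x) differentiable (at x)" using V G by (rule differentiable_diff)
    then obtain D where D: "((\<lambda>x. V x - G x) has_derivative D) (at x)" by (auto simp: differentiable_def)
    have "(f has_derivative D) (at x)"
      by (rule has_derivative_transform_within_open[OF D _ x]) (auto simp: G_def cl_def)
    then show False using nd by (auto simp: differentiable_def)
  qed
qed simp

text \<open>
  On an interval shorter than \<open>\<delta>\<close> every family of disjoint intervals has total length less than \<open>\<delta>\<close>,
  so the variation is bounded there without cutting the families into pieces.
\<close>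

lemma abs_continuous_short_variation:
  fixes f :: "real \<Rightarrow> real"
  assumes small: "\<And>(I::nat set) \<alpha> \<beta>. \<lbrakk>interval_family S I \<alpha> \<beta>; (\<Sum>i\<in>I. \<beta> i - \<alpha> i) < \<delta>\<rbrakk>
     \<Longrightarrow> (\<Sum>i\<in>I. norm (f (\<beta> i) - f (\<alpha> i))) < 1"
    and "{p..q} \<subseteq> S" "p \<le> q" "q - p < \<delta>"
  shows "bdd_above (variation_sums f p q)"
proof (rule bdd_aboveI[of _ 1])
  fix w assume "w \<in> variation_sums f p q"
  then obtain n :: nat and \<alpha> \<beta> where fam: "interval_family {p..q} {..<n} \<alpha> \<beta>"
    and w: "w = (\<Sum>k<n. \<bar>f (\<beta> k) - f (\<alpha> k)\<bar>)" by (auto simp: variation_sums_def)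
  have "(\<Sum>k<n. \<beta> k - \<alpha> k) \<le> measure lebesgue {p..q}"
    using fam by (intro interval_family_length_le_measure[OF fam])
      (force simp: interval_family_def subset_iff)+
  then have "(\<Sum>k<n. \<beta> k - \<alpha> k) < \<delta>" using assms by simp
  moreover have "interval_family S {..<n} \<alpha> \<beta>"
    using interval_family_mono[OF fam assms(2)] .
  ultimately show "w \<le> 1" using small[of "{..<n}" \<alpha> \<beta>] by (simp add: w)
qed

text \<open>
  A set is negligible if it is negligible near each of its points, so variation bounds on short
  intervals are enough.
\<close>

lemma abs_continuous_real_differentiable_ae:
  fixes f :: "real \<Rightarrow> real"
  assumes ac: "abs_continuous_on {a..b} f"
  shows "negligible {x \<in> {a<..<b}. \<not> f differentiable (at x)}" (is "negligible ?S")
proof -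
  obtain \<delta> where \<delta>: "0 < \<delta>" and small:
    "\<And>(I::nat set) \<alpha> \<beta>. \<lbrakk>interval_family {a..b} I \<alpha> \<beta>; (\<Sum>i\<in>I. \<beta> i - \<alpha> i) < \<delta>\<rbrakk>
     \<Longrightarrow> (\<Sum>i\<in>I. norm (f (\<beta> i) - f (\<alpha> i))) < 1"
    by (rule abs_continuous_onE_family[OF ac zero_less_one]) (rule that)
  show ?thesis
  proof (rule locally_negligible_alt[THEN iffD2], rule ballI)
    fix x assume x: "x \<in> ?S"
    define p where "p = max a (x - \<delta> / 3)"
    define q where "q = min b (x + \<delta> / 3)"
    have pq: "{p..q} \<subseteq> {a..b}" "p \<le> q" "q - p < \<delta>" using x \<delta> by (auto simp: p_def q_def)
    have "negligible {x \<in> {p<..<q}. \<not> f differentiable (at x)}"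
      by (rule bounded_variation_differentiable_ae[OF abs_continuous_short_variation[OF small pq]])
    moreover have "?S \<inter> {p<..<q} \<subseteq> {x \<in> {p<..<q}. \<not> f differentiable (at x)}" by auto
    ultimately have "negligible (?S \<inter> {p<..<q})" by (rule negligible_subset)
    moreover have "openin (top_of_set ?S) (?S \<inter> {p<..<q})" by (simp add: openin_open_Int)
    moreover have "x \<in> ?S \<inter> {p<..<q}" using x \<delta> by (auto simp: p_def q_def)
    ultimately show "\<exists>U. openin (top_of_set ?S) U \<and> x \<in> U \<and> negligible U" by blast
  qed
qed

lemma abs_continuous_on_inner:
  fixes f :: "real \<Rightarrow> 'a::real_inner"
  assumes ac: "abs_continuous_on S f" and "norm b = 1"
  shows "abs_continuous_on S (\<lambda>x. f x \<bullet> b)"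
  unfolding abs_continuous_on_def
proof (intro allI impI)
  fix e :: real assume "0 < e"
  then have "\<exists>d>0. \<forall>(n::nat) (\<alpha>::nat \<Rightarrow> real) (\<beta>::nat \<Rightarrow> real).
        (\<forall>k<n. \<alpha> k \<le> \<beta> k \<and> {\<alpha> k..\<beta> k} \<subseteq> S) \<and>
        disjoint_family_on (\<lambda>k. {\<alpha> k<..<\<beta> k}) {..<n} \<and>
        (\<Sum>k<n. \<beta> k - \<alpha> k) < d
        \<longrightarrow> (\<Sum>k<n. norm (f (\<beta> k) - f (\<alpha> k))) < e"
    using ac unfolding abs_continuous_on_def by simp
  then obtain d where "0 < d" and d: "\<forall>(n::nat) (\<alpha>::nat \<Rightarrow> real) (\<beta>::nat \<Rightarrow> real).
        (\<forall>k<n. \<alpha> k \<le> \<beta> k \<and> {\<alpha> k..\<beta> k} \<subseteq> S) \<and>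
        disjoint_family_on (\<lambda>k. {\<alpha> k<..<\<beta> k}) {..<n} \<and>
        (\<Sum>k<n. \<beta> k - \<alpha> k) < d
        \<longrightarrow> (\<Sum>k<n. norm (f (\<beta> k) - f (\<alpha> k))) < e"
    by (elim exE conjE)
  show "\<exists>d>0. \<forall>(n::nat) (\<alpha>::nat \<Rightarrow> real) (\<beta>::nat \<Rightarrow> real).
        (\<forall>k<n. \<alpha> k \<le> \<beta> k \<and> {\<alpha> k..\<beta> k} \<subseteq> S) \<and>
        disjoint_family_on (\<lambda>k. {\<alpha> k<..<\<beta> k}) {..<n} \<and>
        (\<Sum>k<n. \<beta> k - \<alpha> k) < d
        \<longrightarrow> (\<Sum>k<n. norm (f (\<beta> k) \<bullet> b - f (\<alpha> k) \<bullet> b)) < e"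
  proof (intro exI[of _ d] conjI allI impI \<open>0 < d\<close>)
    fix n :: nat and \<alpha> \<beta> :: "nat \<Rightarrow> real"
    assume A: "(\<forall>k<n. \<alpha> k \<le> \<beta> k \<and> {\<alpha> k..\<beta> k} \<subseteq> S) \<and>
        disjoint_family_on (\<lambda>k. {\<alpha> k<..<\<beta> k}) {..<n} \<and> (\<Sum>k<n. \<beta> k - \<alpha> k) < d"
    have "norm (f (\<beta> k) \<bullet> b - f (\<alpha> k) \<bullet> b) \<le> norm (f (\<beta> k) - f (\<alpha> k))" for k
      using Cauchy_Schwarz_ineq2[of "f (\<beta> k) - f (\<alpha> k)" b] assms(2) by (simp add: inner_diff_left)
    then have "(\<Sum>k<n. norm (f (\<beta> k) \<bullet> b - f (\<alpha> k) \<bullet> b)) \<le> (\<Sum>k<n. norm (f (\<beta> k) - f (\<alpha> k)))"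
      by (rule sum_mono)
    also have "\<dots> < e" using d A by blast
    finally show "(\<Sum>k<n. norm (f (\<beta> k) \<bullet> b - f (\<alpha> k) \<bullet> b)) < e" .
  qed
qed

lemma abs_continuous_differentiable_ae:
  fixes f :: "real \<Rightarrow> 'a::euclidean_space"
  assumes ac: "abs_continuous_on {a..b} f"
  shows "negligible {x \<in> {a<..<b}. \<not> f differentiable (at x)}"
proof -
  have "negligible {x \<in> {a<..<b}. \<not> (\<lambda>x. f x \<bullet> i) differentiable (at x)}" if "i \<in> Basis" for i
    using abs_continuous_real_differentiable_ae[OF abs_continuous_on_inner[OF ac]] that by simp
  then have "negligible (\<Union>i\<in>Basis. {x \<in> {a<..<b}. \<not> (\<lambda>x. f x \<bullet> i) differentiable (at x)})"
    by (intro negligible_Union) auto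
  then show ?thesis
    by (rule negligible_subset) (auto simp: differentiable_componentwise_within[of f])
qed

text \<open>
  The end points are put into the exceptional set: inside the interval the one-sided restriction
  of the derivative is immaterial.
\<close>

lemma abs_continuous_imp_derivative_on:
  fixes f :: "real \<Rightarrow> 'a::euclidean_space"
  assumes ac: "abs_continuous_on {a..b} f"
  obtains E where "negligible E"
    "\<And>x. \<lbrakk>x \<in> {a..b}; x \<notin> E\<rbrakk>
      \<Longrightarrow> (f has_vector_derivative vector_derivative f (at x within {a..b})) (at x within {a..b})"
proof (rule that)
  let ?E = "insert a (insert b {x \<in> {a<..<b}. \<not> f differentiable (at x)})"
  show "negligible ?E" using abs_continuous_differentiable_ae[OF ac] by simp
  fix x assume "x \<in> {a..b}" "x \<notin> ?E"
  then have "x \<in> {a<..<b}" "f differentiable (at x)" by auto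
  then have "f differentiable (at x within {a..b})" by (meson differentiable_at_withinI)
  then show "(f has_vector_derivative vector_derivative f (at x within {a..b})) (at x within {a..b})"
    by (simp add: vector_derivative_works)
qed

lemma absolutely_integrable_on_short_pieces:
  fixes h :: "real \<Rightarrow> 'a::euclidean_space"
  assumes "0 < \<delta>"
    and short: "\<And>s t. \<lbrakk>a \<le> s; s \<le> t; t \<le> b; t - s \<le> \<delta>\<rbrakk> \<Longrightarrow> h absolutely_integrable_on {s..t}"
  shows "h absolutely_integrable_on {a..b}"
proof -
  have "h absolutely_integrable_on {s..t}" if "a \<le> s" "s \<le> t" "t \<le> b" "t - s \<le> real n * \<delta>" for s t n
    using that
  proof (induction n arbitrary: s)
    case 0
    then have "t = s" by simp
    then show ?case using short[of s s] 0 \<open>0 < \<delta>\<close> by simp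
  next
    case (Suc n)
    define m where "m = min t (s + \<delta>)"
    have m: "s \<le> m" "m \<le> t" "m - s \<le> \<delta>" "t - m \<le> real n * \<delta>"
      using Suc.prems \<open>0 < \<delta>\<close> by (auto simp: m_def min_def algebra_simps)
    have "h absolutely_integrable_on {s..m}" using m Suc.prems by (intro short) auto
    moreover have "h absolutely_integrable_on {m..t}" using m Suc.prems by (intro Suc.IH) auto
    ultimately have "h absolutely_integrable_on ({s..m} \<union> {m..t})"
      by (rule set_integrable_Un) auto
    then show ?case using m by (simp add: ivl_disj_un_two_touch)
  qed note * = this
  show ?thesis
  proof (cases "a \<le> b")
    case True
    obtain n where "(b - a) / \<delta> < real n" using reals_Archimedean2 by blast
    then have "b - a \<le> real n * \<delta>" using \<open>0 < \<delta>\<close> by (simp add: field_simps)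
    then show ?thesis using *[of a b n] True by simp
  qed simp
qed

text \<open>
  On short intervals the integrals of the derivative over the pieces of a division are the increments
  of \<open>f\<close>, whose sum is bounded by absolute continuity; a gauge integral of bounded variation is
  absolutely convergent.
\<close>

theorem abs_continuous_derivative_absolutely_integrable:
  fixes f :: "real \<Rightarrow> 'a::euclidean_space"
  assumes ac: "abs_continuous_on {a..b} f"
  shows "(\<lambda>x. vector_derivative f (at x within {a..b})) absolutely_integrable_on {a..b}"
    and "\<lbrakk>a \<le> s; s \<le> t; t \<le> b\<rbrakk> \<Longrightarrow>
      ((\<lambda>x. vector_derivative f (at x within {a..b})) has_integral (f t - f s)) {s..t}"
proof -
  let ?f' = "\<lambda>x. vector_derivative f (at x within {a..b})"
  obtain E where E: "negligible E"
    "\<And>x. \<lbrakk>x \<in> {a..b}; x \<notin> E\<rbrakk> \<Longrightarrow> (f has_vector_derivative ?f' x) (at x within {a..b})"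
    using abs_continuous_imp_derivative_on[OF ac] by metis
  have ftc: "(?f' has_integral (f t - f s)) {s..t}" if "a \<le> s" "s \<le> t" "t \<le> b" for s t
  proof -
    have sub: "{s..t} \<subseteq> {a..b}" using that by auto
    have "((\<lambda>x. if x \<in> E then 0 else ?f' x) has_integral (f t - f s)) {s..t}"
      by (rule abs_continuous_has_integral_derivative[OF \<open>s \<le> t\<close> abs_continuous_on_subset[OF ac sub] E(1)])
         (use E(2) sub in \<open>blast intro: has_vector_derivative_within_subset\<close>)
    then show ?thesis
      by (rule has_integral_spike[OF E(1), rotated]) auto
  qed
  then show "\<lbrakk>a \<le> s; s \<le> t; t \<le> b\<rbrakk> \<Longrightarrow> (?f' has_integral (f t - f s)) {s..t}" .
  obtain \<delta> where \<delta>: "0 < \<delta>" and small: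
    "\<And>(I::real set set) \<alpha> \<beta>. \<lbrakk>interval_family {a..b} I \<alpha> \<beta>; (\<Sum>i\<in>I. \<beta> i - \<alpha> i) < \<delta>\<rbrakk>
     \<Longrightarrow> (\<Sum>i\<in>I. norm (f (\<beta> i) - f (\<alpha> i))) < 1"
    by (rule abs_continuous_onE_family[OF ac zero_less_one]) (rule that)
  show "?f' absolutely_integrable_on {a..b}"
  proof (rule absolutely_integrable_on_short_pieces)
    show "0 < \<delta> / 2" using \<delta> by simp
    fix s t assume st: "a \<le> s" "s \<le> t" "t \<le> b" "t - s \<le> \<delta> / 2"
    have "?f' absolutely_integrable_on cbox s t"
    proof (rule bounded_variation_absolutely_integrable_interval[where B = 1])
      show "?f' integrable_on cbox s t" using ftc[of s t] st by (auto simp: integrable_on_def)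
      fix d assume d: "d division_of cbox s t"
      have K: "\<exists>u v. K = {u..v} \<and> u \<le> v \<and> s \<le> u \<and> v \<le> t" if K: "K \<in> d" for K
      proof -
        obtain u v where "K = cbox u v" using division_ofD(4)[OF d K] by blast
        moreover have "K \<subseteq> {s..t}" "K \<noteq> {}" using division_ofD(2,3)[OF d K] by auto
        ultimately show ?thesis by (intro exI[of _ u] exI[of _ v]) auto
      qed
      have fam: "interval_family {s..t} d Inf Sup"
        unfolding interval_family_def
      proof (intro conjI ballI impI)
        show "finite d" using d by blast
        fix K L assume KL: "K \<in> d" "L \<in> d" "K \<noteq> L"
        have io: "interior J = {Inf J<..<Sup J}" if "J \<in> d" for J using K[OF that] by auto
        show "{Inf K<..<Sup K} \<inter> {Inf L<..<Sup L} = {}"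
          using division_ofD(5)[OF d KL] io KL by simp
      next
        fix J assume "J \<in> d"
        then show "Inf J \<le> Sup J" "{Inf J..Sup J} \<subseteq> {s..t}" using K[of J] by auto
      qed
      have "(\<Sum>K\<in>d. Sup K - Inf K) \<le> measure lebesgue {s..t}"
        by (intro interval_family_length_le_measure[OF fam]) (use K in force)+
      then have "(\<Sum>K\<in>d. Sup K - Inf K) < \<delta>" using st \<delta> by simp
      moreover have "interval_family {a..b} d Inf Sup"
        by (rule interval_family_mono[OF fam]) (use st in auto)
      ultimately have "(\<Sum>K\<in>d. norm (f (Sup K) - f (Inf K))) < 1" using small by blast
      moreover have "integral K ?f' = f (Sup K) - f (Inf K)" if Kd: "K \<in> d" for K
      proof -
        obtain u v where "K = {u..v}" "u \<le> v" "s \<le> u" "v \<le> t" using K[OF Kd] by blast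
        then show ?thesis using ftc[of u v] st by (auto simp: integral_unique)
      qed
      ultimately show "(\<Sum>K\<in>d. norm (integral K ?f')) \<le> 1" by simp
    qed
    then show "?f' absolutely_integrable_on {s..t}" by simp
  qed
qed
lemma absolutely_integrable_Max:
  fixes \<phi> :: "'i \<Rightarrow> 'a::euclidean_space \<Rightarrow> real"
  assumes "finite J" "J \<noteq> {}" "\<And>j. j \<in> J \<Longrightarrow> \<phi> j absolutely_integrable_on S"
  shows "(\<lambda>x. MAX j\<in>J. \<phi> j x) absolutely_integrable_on S"
  using assms
proof (induction J rule: finite_ne_induct)
  case (insert j J)
  then have "(\<lambda>x. max (\<phi> j x) (MAX j\<in>J. \<phi> j x)) absolutely_integrable_on S"
    by (intro absolutely_integrable_max_1) auto
  then show ?case using insert by (simp add: Max_insert)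
qed simp

text \<open>
  The inner integral of the constant \<open>C\<close>: the maximal speed of finitely many absolutely continuous
  curves is Lebesgue integrable and its integral dominates all their increments.
\<close>

lemma abs_continuous_max_speed:
  fixes g :: "'i \<Rightarrow> real \<Rightarrow> 'a::euclidean_space"
  assumes J: "finite J" "J \<noteq> {}" and ac: "\<And>j. j \<in> J \<Longrightarrow> abs_continuous_on {a..b} (g j)"
  defines "w \<equiv> \<lambda>\<sigma>. MAX j\<in>J. norm (vector_derivative (g j) (at \<sigma> within {a..b}))"
  shows "w absolutely_integrable_on {a..b}"
    and "\<lbrakk>j \<in> J; a \<le> s; s \<le> t; t \<le> b\<rbrakk> \<Longrightarrow> norm (g j t - g j s) \<le> integral {s..t} w"
    and "0 \<le> w \<sigma>"
proof -
  show w: "w absolutely_integrable_on {a..b}"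
    unfolding w_def
    by (intro absolutely_integrable_Max J set_integrable_norm
        abs_continuous_derivative_absolutely_integrable(1) ac)
  have le: "norm (vector_derivative (g j) (at \<sigma> within {a..b})) \<le> w \<sigma>" if "j \<in> J" for j \<sigma>
    unfolding w_def using J that by (intro Max_ge) auto
  show "0 \<le> w \<sigma>" using J le by (meson all_not_in_conv norm_ge_zero order_trans)
  assume st: "j \<in> J" "a \<le> s" "s \<le> t" "t \<le> b"
  have "w integrable_on {a..b}" using w by (rule set_lebesgue_integral_eq_integral(1))
  then have "w integrable_on {s..t}" using st by (auto intro: integrable_on_subinterval)
  moreover have "((\<lambda>x. vector_derivative (g j) (at x within {a..b})) has_integral (g j t - g j s)) {s..t}"
    using abs_continuous_derivative_absolutely_integrable(2)[OF ac[OF st(1)] st(2-4)] .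
  ultimately show "norm (g j t - g j s) \<le> integral {s..t} w"
    using le[OF st(1)] integral_norm_bound_integral[of _ "{s..t}" w]
    by (metis (no_types, lifting) has_integral_integrable integral_unique)
qed

lemma lipschitz_on_imp_abs_continuous_on:
  fixes f :: "real \<Rightarrow> 'a::real_normed_vector"
  assumes lip: "L-lipschitz_on S f"
  shows "abs_continuous_on S f"
  unfolding abs_continuous_on_def
proof (intro allI impI)
  fix e :: real assume "0 < e"
  have L: "0 \<le> L" using lip by (rule lipschitz_on_nonneg)
  show "\<exists>d>0. \<forall>(n::nat) (\<alpha>::nat \<Rightarrow> real) (\<beta>::nat \<Rightarrow> real).
        (\<forall>k<n. \<alpha> k \<le> \<beta> k \<and> {\<alpha> k..\<beta> k} \<subseteq> S) \<and>
        disjoint_family_on (\<lambda>k. {\<alpha> k<..<\<beta> k}) {..<n} \<and>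
        (\<Sum>k<n. \<beta> k - \<alpha> k) < d
        \<longrightarrow> (\<Sum>k<n. norm (f (\<beta> k) - f (\<alpha> k))) < e"
  proof (intro exI[of _ "e / (L + 1)"] conjI allI impI)
    show "0 < e / (L + 1)" using L \<open>0 < e\<close> by simp
    fix n :: nat and \<alpha> \<beta> :: "nat \<Rightarrow> real"
    assume A: "(\<forall>k<n. \<alpha> k \<le> \<beta> k \<and> {\<alpha> k..\<beta> k} \<subseteq> S) \<and>
        disjoint_family_on (\<lambda>k. {\<alpha> k<..<\<beta> k}) {..<n} \<and> (\<Sum>k<n. \<beta> k - \<alpha> k) < e / (L + 1)"
    have "(\<Sum>k<n. norm (f (\<beta> k) - f (\<alpha> k))) \<le> (\<Sum>k<n. L * (\<beta> k - \<alpha> k))"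
    proof (rule sum_mono)
      fix k assume "k \<in> {..<n}"
      then have "\<alpha> k \<le> \<beta> k" "{\<alpha> k..\<beta> k} \<subseteq> S" using A by auto
      then have "\<alpha> k \<le> \<beta> k" "\<alpha> k \<in> S" "\<beta> k \<in> S" by (auto simp: subset_iff)
      then show "norm (f (\<beta> k) - f (\<alpha> k)) \<le> L * (\<beta> k - \<alpha> k)"
        using lipschitz_onD[OF lip, of "\<beta> k" "\<alpha> k"] by (simp add: dist_norm)
    qed
    also have "\<dots> \<le> (L + 1) * (\<Sum>k<n. \<beta> k - \<alpha> k)"
      unfolding sum_distrib_left[symmetric]
      using A by (intro mult_right_mono sum_nonneg) auto
    also have "\<dots> < e" using A L by (simp add: pos_less_divide_eq mult.commute)
    finally show "(\<Sum>k<n. norm (f (\<beta> k) - f (\<alpha> k))) < e" .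
  qed
qed

text \<open>
  A Lipschitz function is the integral of its derivative, so the almost everywhere bound \<open>c\<close> on the
  derivative is a Lipschitz constant.
\<close>

lemma admissible_delay_lipschitz:
  assumes adm: "admissible_delay \<tau> \<tau>bar c" and st: "0 \<le> s" "s \<le> t"
  shows "\<bar>\<tau> t - \<tau> s\<bar> \<le> c * (t - s)"
proof -
  obtain L where lip: "L-lipschitz_on {0..} \<tau>" using adm by (auto simp: admissible_delay_def)
  have ae: "AE t in lebesgue. 0 < t \<longrightarrow> (\<exists>D. (\<tau> has_real_derivative D) (at t) \<and> \<bar>D\<bar> \<le> c)" and "0 < c"
    using adm by (auto simp: admissible_delay_def)
  from ae obtain N where N: "N \<in> null_sets lebesgue"
    "{t. \<not> (0 < t \<longrightarrow> (\<exists>D. (\<tau> has_real_derivative D) (at t) \<and> \<bar>D\<bar> \<le> c))} \<subseteq> N"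
    by (auto simp: eventually_ae_filter)
  \<comment> \<open>The bound on the derivative is only assumed for positive times.\<close>
  define E where "E = insert 0 N"
  have E: "negligible E" using N by (simp add: E_def negligible_iff_null_sets[symmetric])
  have der: "\<exists>D. (\<tau> has_real_derivative D) (at t) \<and> \<bar>D\<bar> \<le> c" if "0 \<le> t" "t \<notin> E" for t
  proof -
    have "0 < t" using that unfolding E_def by (cases "t = 0") auto
    then show ?thesis using N(2) that unfolding E_def by blast
  qed
  define \<tau>' where "\<tau>' t = (SOME D. (\<tau> has_real_derivative D) (at t) \<and> \<bar>D\<bar> \<le> c)" for t
  have \<tau>': "(\<tau> has_real_derivative \<tau>' t) (at t)" "\<bar>\<tau>' t\<bar> \<le> c" if "0 \<le> t" "t \<notin> E" for t
    using someI_ex[OF der[OF that]] by (simp_all add: \<tau>'_def)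
  have "abs_continuous_on {s..t} \<tau>"
    using lipschitz_on_imp_abs_continuous_on[OF lip] by (rule abs_continuous_on_subset) (use st in auto)
  then have "((\<lambda>x. if x \<in> E then 0 else \<tau>' x) has_integral (\<tau> t - \<tau> s)) {s..t}"
    using st(2) E \<tau>'(1) st(1)
    by (intro abs_continuous_has_integral_derivative)
       (auto simp: has_real_derivative_iff_has_vector_derivative[symmetric] intro: has_field_derivative_at_within)
  then have "norm (\<tau> t - \<tau> s) \<le> c * measure lborel {s..t}"
    using \<tau>'(2) \<open>0 < c\<close> st(1) by (intro has_integral_bound_real[where f = "\<lambda>x. if x \<in> E then 0 else \<tau>' x"]) auto
  then show ?thesis using st by simp
qed

section \<open>Upper Dini derivatives and exponential decay\<close>

lemma eventually_at_right_0_less: "0 < b \<Longrightarrow> \<forall>\<^sub>F h in at_right (0::real). h < b"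
  by (auto simp: eventually_at_right[of 0 b])

text \<open>
  The upper right Dini derivative of \<open>f\<close> at \<open>t\<close> is at most \<open>m\<close>.
\<close>

definition upper_dini_le :: "(real \<Rightarrow> real) \<Rightarrow> real \<Rightarrow> real \<Rightarrow> bool" where
  "upper_dini_le f t m \<longleftrightarrow> (\<forall>\<epsilon>>0. \<forall>\<^sub>F h in at_right 0. f (t + h) \<le> f t + h * (m + \<epsilon>))"

lemma upper_dini_leI_tendsto:
  assumes le: "\<forall>\<^sub>F h in at_right 0. f (t + h) \<le> f t + h * B h" and lim: "(B \<longlongrightarrow> m) (at_right 0)"
  shows "upper_dini_le f t m"
  unfolding upper_dini_le_def
proof (intro allI impI)
  fix \<epsilon> :: real assume "0 < \<epsilon>"
  then have "\<forall>\<^sub>F h in at_right 0. B h < m + \<epsilon>" using lim by (intro order_tendstoD) auto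
  then show "\<forall>\<^sub>F h in at_right 0. f (t + h) \<le> f t + h * (m + \<epsilon>)"
    using le eventually_at_right_less[of 0]
  proof eventually_elim
    case (elim h)
    then have "h * B h \<le> h * (m + \<epsilon>)" by (intro mult_left_mono) auto
    then show ?case using elim by linarith
  qed
qed

lemma has_real_derivative_imp_upper_dini_le:
  assumes "(f has_real_derivative D) (at t)"
  shows "upper_dini_le f t D"
proof (rule upper_dini_leI_tendsto)
  show "((\<lambda>h. (f (t + h) - f t) / h) \<longlongrightarrow> D) (at_right 0)"
    using assms unfolding DERIV_def by (rule tendsto_within_subset) auto
  show "\<forall>\<^sub>F h in at_right 0. f (t + h) \<le> f t + h * ((f (t + h) - f t) / h)"
    using eventually_at_right_less[of 0] by eventually_elim simp
qed

lemma upper_dini_le_add: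
  assumes "upper_dini_le f t m" "upper_dini_le g t n"
  shows "upper_dini_le (\<lambda>s. f s + g s) t (m + n)"
  unfolding upper_dini_le_def
proof (intro allI impI)
  fix \<epsilon> :: real assume "0 < \<epsilon>"
  then have "\<forall>\<^sub>F h in at_right 0. f (t + h) \<le> f t + h * (m + \<epsilon>/2)"
    "\<forall>\<^sub>F h in at_right 0. g (t + h) \<le> g t + h * (n + \<epsilon>/2)"
    using assms unfolding upper_dini_le_def by (meson half_gt_zero)+
  then show "\<forall>\<^sub>F h in at_right 0. f (t + h) + g (t + h) \<le> f t + g t + h * (m + n + \<epsilon>)"
    by eventually_elim (simp add: algebra_simps)
qed

lemma upper_dini_le_cmult:
  assumes "upper_dini_le f t m" "0 < k"
  shows "upper_dini_le (\<lambda>s. k * f s) t (k * m)"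
  unfolding upper_dini_le_def
proof (intro allI impI)
  fix \<epsilon> :: real assume "0 < \<epsilon>"
  then have "\<forall>\<^sub>F h in at_right 0. f (t + h) \<le> f t + h * (m + \<epsilon> / k)"
    using assms unfolding upper_dini_le_def by simp
  then show "\<forall>\<^sub>F h in at_right 0. k * f (t + h) \<le> k * f t + h * (k * m + \<epsilon>)"
  proof eventually_elim
    case (elim h)
    then have "k * f (t + h) \<le> k * (f t + h * (m + \<epsilon> / k))" using assms(2) by (intro mult_left_mono) auto
    then show ?case using assms(2) by (simp add: algebra_simps)
  qed
qed

lemma upper_dini_le_mono: "\<lbrakk>upper_dini_le f t m; m \<le> n\<rbrakk> \<Longrightarrow> upper_dini_le f t n"
  unfolding upper_dini_le_def
proof (intro allI impI)
  fix \<epsilon> :: real assume "0 < \<epsilon>" "m \<le> n" and *: "\<forall>\<epsilon>>0. \<forall>\<^sub>F h in at_right 0. f (t + h) \<le> f t + h * (m + \<epsilon>)"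
  from *[rule_format, OF \<open>0 < \<epsilon>\<close>] show "\<forall>\<^sub>F h in at_right 0. f (t + h) \<le> f t + h * (n + \<epsilon>)"
    using eventually_at_right_less[of 0]
  proof eventually_elim
    case (elim h)
    then have "h * (m + \<epsilon>) \<le> h * (n + \<epsilon>)" using \<open>m \<le> n\<close> by (intro mult_left_mono) auto
    then show ?case using elim by linarith
  qed
qed

text \<open>
  The last time \<open>s\<close> up to which \<open>f t \<le> f a + \<epsilon> (t - a)\<close> holds must be \<open>b\<close>, because the Dini
  derivative at an earlier \<open>s\<close> would extend the estimate beyond \<open>s\<close>.
\<close>

lemma upper_dini_nonpos_imp_le:
  fixes f :: "real \<Rightarrow> real"
  assumes "a \<le> b" and cont: "continuous_on {a..b} f"
    and dini: "\<And>t. \<lbrakk>a \<le> t; t < b\<rbrakk> \<Longrightarrow> upper_dini_le f t 0"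
  shows "f b \<le> f a"
proof (rule field_le_epsilon)
  fix e :: real assume "0 < e"
  define \<epsilon> where "\<epsilon> = e / (b - a + 1)"
  have \<epsilon>: "0 < \<epsilon>" "\<epsilon> * (b - a) \<le> e" using \<open>0 < e\<close> \<open>a \<le> b\<close> by (auto simp: \<epsilon>_def field_simps)
  define T where "T = {a..b} \<inter> (\<lambda>t. f t - \<epsilon> * (t - a)) -` {..f a}"
  have "closed T"
    unfolding T_def by (intro continuous_closed_preimage continuous_intros cont closed_atLeastAtMost closed_atMost)
  moreover have "bounded T" by (rule bounded_subset[of "{a..b}"]) (auto simp: T_def)
  ultimately have "compact T" by (simp add: compact_eq_bounded_closed)
  moreover have "a \<in> T" using \<open>a \<le> b\<close> by (simp add: T_def)
  ultimately obtain s where s: "s \<in> T" "\<And>t. t \<in> T \<Longrightarrow> t \<le> s"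
    using compact_attains_sup[of T] by blast
  have "s = b"
  proof (rule ccontr)
    assume "s \<noteq> b"
    then have sb: "a \<le> s" "s < b" using s by (auto simp: T_def)
    have "\<forall>\<^sub>F h in at_right 0. f (s + h) \<le> f s + h * (0 + \<epsilon>)"
      using dini[OF sb] \<epsilon>(1) unfolding upper_dini_le_def by blast
    moreover have "\<forall>\<^sub>F h in at_right 0. h < b - s" using sb by (intro eventually_at_right_0_less) simp
    moreover have "\<forall>\<^sub>F h in at_right (0::real). 0 < h" by (rule eventually_at_right_less)
    ultimately have "\<forall>\<^sub>F h in at_right 0. s + h \<in> T \<and> 0 < h"
    proof eventually_elim
      case (elim h)
      then show ?case using s(1) by (auto simp: T_def algebra_simps)
    qed
    then obtain h where "s + h \<in> T" "0 < h" using eventually_happens'[OF trivial_limit_at_right_real] by blast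
    then show False using s(2)[of "s + h"] by simp
  qed
  then show "f b \<le> f a + e" using s(1) \<epsilon> by (auto simp: T_def)
qed

text \<open>
  The function \<open>F t = e\<^bsup>r t\<^esup> L t\<close> has Dini derivative at most \<open>0\<close> at positive times, hence is
  nonincreasing there, and continuity extends this to \<open>t = 0\<close>.
\<close>

lemma upper_dini_exp_decay:
  fixes L :: "real \<Rightarrow> real"
  assumes cont: "continuous_on {0..} L" and dini: "\<And>t. 0 < t \<Longrightarrow> upper_dini_le L t (- r * L t)" and "0 \<le> t"
  shows "L t \<le> L 0 * exp (- r * t)"
proof -
  define F where "F s = exp (r * s) * L s" for s
  have contF: "continuous_on {0..} F" unfolding F_def by (intro continuous_intros cont)
  have F0: "upper_dini_le F s 0" if "0 < s" for s
    unfolding upper_dini_le_def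
  proof (intro allI impI)
    fix \<epsilon> :: real assume "0 < \<epsilon>"
    \<comment> \<open>An upper bound for the exponential factor near \<open>s\<close>.\<close>
    define M where "M = exp (\<bar>r\<bar> * (s + 1))"
    \<comment> \<open>The linearised product; the two contributions to its derivative at \<open>0\<close> cancel.\<close>
    define q where "q h = exp (r * (s + h)) * (L s - h * r * L s)" for h
    have "(q has_real_derivative 0) (at 0)"
      unfolding q_def by (auto intro!: derivative_eq_intros)
    then have "upper_dini_le q 0 0" by (rule has_real_derivative_imp_upper_dini_le)
    then have "\<forall>\<^sub>F h in at_right 0. q (0 + h) \<le> q 0 + h * (0 + \<epsilon> / 2)"
      unfolding upper_dini_le_def using \<open>0 < \<epsilon>\<close> half_gt_zero by blast
    moreover have "\<forall>\<^sub>F h in at_right 0. L (s + h) \<le> L s + h * (- r * L s + \<epsilon> / (2 * M))"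
      using dini[OF that] \<open>0 < \<epsilon>\<close> unfolding upper_dini_le_def by (simp add: M_def)
    moreover have "\<forall>\<^sub>F h in at_right (0::real). 0 < h" by (rule eventually_at_right_less)
    moreover have "\<forall>\<^sub>F h in at_right 0. h < (1::real)" by (intro eventually_at_right_0_less) simp
    ultimately show "\<forall>\<^sub>F h in at_right 0. F (s + h) \<le> F s + h * (0 + \<epsilon>)"
    proof eventually_elim
      case (elim h)
      have "r * (s + h) \<le> \<bar>r\<bar> * (s + 1)" using elim that by (intro mult_mono) auto
      then have M: "exp (r * (s + h)) \<le> M" "0 < M" by (auto simp: M_def)
      have "F (s + h) \<le> exp (r * (s + h)) * (L s + h * (- r * L s + \<epsilon> / (2 * M)))"
        unfolding F_def using elim by (intro mult_left_mono) auto
      also have "\<dots> = q h + exp (r * (s + h)) * (h * (\<epsilon> / (2 * M)))" by (simp add: q_def algebra_simps)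
      also have "exp (r * (s + h)) * (h * (\<epsilon> / (2 * M))) \<le> M * (h * (\<epsilon> / (2 * M)))"
        using M elim \<open>0 < \<epsilon>\<close> by (intro mult_right_mono) auto
      also have "M * (h * (\<epsilon> / (2 * M))) = h * (\<epsilon> / 2)" using M(2) by simp
      finally show ?case using elim by (simp add: F_def q_def algebra_simps)
    qed
  qed
  have mono: "F t \<le> F s" if "0 < s" "s \<le> t" for s
    by (rule upper_dini_nonpos_imp_le[OF that(2)])
       (use that F0 in \<open>auto intro: continuous_on_subset[OF contF]\<close>)
  have "F t \<le> F 0"
  proof (cases "t = 0")
    case False
    then have "0 < t" using \<open>0 \<le> t\<close> by simp
    have "(F \<longlongrightarrow> F 0) (at 0 within {0..})"
      using contF by (simp add: continuous_on_def)
    then have "(F \<longlongrightarrow> F 0) (at_right 0)" by (simp add: at_within_Ici_at_right)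
    moreover have "\<forall>\<^sub>F s in at_right 0. F t \<le> F s"
      using eventually_at_right_less[of 0] eventually_at_right_0_less[OF \<open>0 < t\<close>]
      by eventually_elim (auto intro: mono)
    ultimately show ?thesis by (intro tendsto_lowerbound) auto
  qed simp
  then show ?thesis by (simp add: F_def exp_minus field_simps)
qed

section \<open>Delayed averaging\<close>

text \<open>
  The difference of the means is the sum of \<open>\<alpha> i \<beta> j (u i - u j)\<close>.  Replacing \<open>\<alpha> i \<beta> j\<close> by the
  smaller weight of the unordered pair changes nothing when subtracted, since that weight is
  symmetric and \<open>u i - u j\<close> antisymmetric; what remains are nonnegative weights of total mass at
  most \<open>1 - \<psi>\<close>.
\<close>

lemma convex_means_contract:
  fixes \<alpha> \<beta> :: "'i \<Rightarrow> real" and u :: "'i \<Rightarrow> 'a::real_normed_vector"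
  assumes fin: "finite I" and one: "sum \<alpha> I = 1" "sum \<beta> I = 1"
    and \<psi>: "\<psi> \<le> (\<Sum>i\<in>I. \<Sum>j\<in>I. min (\<alpha> i * \<beta> j) (\<alpha> j * \<beta> i))"
    and D: "\<And>i j. \<lbrakk>i \<in> I; j \<in> I\<rbrakk> \<Longrightarrow> norm (u i - u j) \<le> D"
  shows "norm ((\<Sum>i\<in>I. \<alpha> i *\<^sub>R u i) - (\<Sum>j\<in>I. \<beta> j *\<^sub>R u j)) \<le> (1 - \<psi>) * D"
proof -
  define m where "m i j = min (\<alpha> i * \<beta> j) (\<alpha> j * \<beta> i)" for i j
  have sym: "m i j = m j i" for i j by (simp add: m_def min.commute)
  have "I \<noteq> {}" using one by auto
  then have D0: "0 \<le> D" using D by force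
  have "(\<Sum>i\<in>I. \<Sum>j\<in>I. m i j *\<^sub>R u j) = (\<Sum>j\<in>I. \<Sum>i\<in>I. m i j *\<^sub>R u j)" by (rule sum.swap)
  also have "\<dots> = (\<Sum>i\<in>I. \<Sum>j\<in>I. m i j *\<^sub>R u i)" by (subst sym) simp
  finally have m0: "(\<Sum>i\<in>I. \<Sum>j\<in>I. m i j *\<^sub>R (u i - u j)) = 0"
    by (simp add: scaleR_diff_right sum_subtractf)
  have "(\<Sum>i\<in>I. \<Sum>j\<in>I. (\<alpha> i * \<beta> j) *\<^sub>R u i) = (\<Sum>i\<in>I. \<alpha> i *\<^sub>R u i)"
    by (simp add: scaleR_sum_left[symmetric] sum_distrib_left[symmetric] one)
  moreover have "(\<Sum>i\<in>I. \<Sum>j\<in>I. (\<alpha> i * \<beta> j) *\<^sub>R u j) = (\<Sum>j\<in>I. \<beta> j *\<^sub>R u j)"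
    by (subst sum.swap) (simp add: scaleR_sum_left[symmetric] sum_distrib_right[symmetric] one)
  ultimately have "(\<Sum>i\<in>I. \<alpha> i *\<^sub>R u i) - (\<Sum>j\<in>I. \<beta> j *\<^sub>R u j) = (\<Sum>i\<in>I. \<Sum>j\<in>I. (\<alpha> i * \<beta> j) *\<^sub>R (u i - u j))"
    by (simp add: scaleR_diff_right sum_subtractf)
  also have "\<dots> = (\<Sum>i\<in>I. \<Sum>j\<in>I. (\<alpha> i * \<beta> j - m i j) *\<^sub>R (u i - u j))"
    using m0 by (simp add: scaleR_diff_left sum_subtractf)
  also have "norm \<dots> \<le> (\<Sum>i\<in>I. \<Sum>j\<in>I. (\<alpha> i * \<beta> j - m i j) * D)"
  proof (intro sum_norm_le)
    fix i j assume "i \<in> I" "j \<in> I"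
    then show "norm ((\<alpha> i * \<beta> j - m i j) *\<^sub>R (u i - u j)) \<le> (\<alpha> i * \<beta> j - m i j) * D"
      using D[of i j] by (simp add: m_def mult_left_mono)
  qed
  also have "\<dots> = (1 - (\<Sum>i\<in>I. \<Sum>j\<in>I. m i j)) * D"
    by (simp add: sum_distrib_right[symmetric] sum_subtractf sum_distrib_left[symmetric] one)
  also have "\<dots> \<le> (1 - \<psi>) * D"
    using \<psi> D0 unfolding m_def by (intro mult_right_mono) auto
  finally show ?thesis .
qed

lemma mean_minus_point:
  fixes u :: "'i \<Rightarrow> 'a::real_vector"
  assumes "sum \<alpha> I = 1"
  shows "(\<Sum>j\<in>I. \<alpha> j *\<^sub>R u j) - c = (\<Sum>j\<in>I. \<alpha> j *\<^sub>R (u j - c))"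
proof -
  have "(\<Sum>j\<in>I. \<alpha> j *\<^sub>R c) = c" using assms by (simp add: scaleR_sum_left[symmetric])
  then show ?thesis by (simp add: scaleR_diff_right sum_subtractf)
qed

text \<open>
  Exchanging the delayed values \<open>z j\<close> for the current ones \<open>y j\<close> costs at most \<open>\<sigma>\<close> per unit of
  off-diagonal weight, of which there is at most \<open>n\<close>, and the diagonal weight multiplies \<open>y i - y i = 0\<close>.  After the exchange the
  diagonal term can therefore be included, and the rate is relaxation towards a weighted mean.
\<close>

lemma delayed_rate_perturbation:
  fixes y z :: "'i \<Rightarrow> 'a::real_normed_vector" and A :: "'i \<Rightarrow> real"
  assumes fin: "finite I" and i: "i \<in> I" and "0 < n" "0 \<le> lam"
    and A: "\<And>j. j \<in> I - {i} \<Longrightarrow> 0 \<le> A j" and Ai: "A i = n - (\<Sum>j\<in>I - {i}. A j)" "0 \<le> A i"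
    and \<sigma>: "\<And>j. j \<in> I \<Longrightarrow> norm (z j - y j) \<le> \<sigma>"
  shows "norm ((lam / n) *\<^sub>R (\<Sum>j\<in>I - {i}. A j *\<^sub>R (z j - y i)) -
           lam *\<^sub>R ((\<Sum>j\<in>I. (A j / n) *\<^sub>R y j) - y i)) \<le> lam * \<sigma>"
proof -
  have \<sigma>0: "0 \<le> \<sigma>" using \<sigma>[OF i] norm_ge_zero order_trans by blast
  have sumA: "(\<Sum>j\<in>I. A j) = n" using fin i Ai by (simp add: sum.remove)
  have "(\<Sum>j\<in>I. (A j / n) *\<^sub>R y j) - y i = (\<Sum>j\<in>I. (A j / n) *\<^sub>R (y j - y i))"
    using sumA \<open>0 < n\<close> by (intro mean_minus_point) (simp add: sum_divide_distrib[symmetric])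
  also have "\<dots> = (\<Sum>j\<in>I - {i}. (A j / n) *\<^sub>R (y j - y i))"
    using fin i by (simp add: sum.remove)
  finally have "lam *\<^sub>R ((\<Sum>j\<in>I. (A j / n) *\<^sub>R y j) - y i) = (lam / n) *\<^sub>R (\<Sum>j\<in>I - {i}. A j *\<^sub>R (y j - y i))"
    by (simp add: scaleR_sum_right)
  then have "(lam / n) *\<^sub>R (\<Sum>j\<in>I - {i}. A j *\<^sub>R (z j - y i)) -
        lam *\<^sub>R ((\<Sum>j\<in>I. (A j / n) *\<^sub>R y j) - y i) = (lam / n) *\<^sub>R (\<Sum>j\<in>I - {i}. A j *\<^sub>R (z j - y j))"
    by (simp add: scaleR_diff_right[symmetric] sum_subtractf[symmetric])
  also have "norm \<dots> = lam / n * norm (\<Sum>j\<in>I - {i}. A j *\<^sub>R (z j - y j))"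
    using \<open>0 < n\<close> \<open>0 \<le> lam\<close> by simp
  also have "\<dots> \<le> lam / n * (\<Sum>j\<in>I - {i}. A j * \<sigma>)"
    using \<open>0 < n\<close> \<open>0 \<le> lam\<close> A \<sigma>
    by (intro mult_left_mono sum_norm_le) (auto simp: abs_of_nonneg intro: mult_left_mono)
  also have "\<dots> \<le> lam / n * (n * \<sigma>)"
    using \<open>0 < n\<close> \<open>0 \<le> lam\<close> \<sigma>0 Ai
    by (intro mult_left_mono) (auto simp: sum_distrib_right[symmetric] intro: mult_right_mono)
  also have "\<dots> = lam * \<sigma>" using \<open>0 < n\<close> by simp
  finally show ?thesis .
qed
section \<open>The memory of the delay\<close>

lemma continuous_on_Max_family:
  fixes f :: "'i \<Rightarrow> 'a::topological_space \<Rightarrow> real"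
  assumes "finite J" "J \<noteq> {}" "\<And>j. j \<in> J \<Longrightarrow> continuous_on S (f j)"
  shows "continuous_on S (\<lambda>x. MAX j\<in>J. f j x)"
  using assms
proof (induction J rule: finite_ne_induct)
  case (insert j J)
  then have "continuous_on S (\<lambda>x. max (f j x) (MAX j\<in>J. f j x))"
    by (intro continuous_intros) auto
  then show ?case using insert by (simp add: Max_insert)
qed simp

lemma integral_from_left_endpoint:
  fixes f :: "real \<Rightarrow> real"
  assumes f: "continuous_on {a..} f"
  shows "continuous_on {a..} (\<lambda>t. integral {a..t} f)"
    and "a < t \<Longrightarrow> ((\<lambda>t. integral {a..t} f) has_real_derivative f t) (at t)"
proof -
  have deriv: "((\<lambda>t. integral {a..t} f) has_real_derivative f t) (at t within {a..b})" if "t \<in> {a..b}" for t b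
    using that by (intro integral_has_real_derivative continuous_on_subset[OF f]) auto
  show "continuous_on {a..} (\<lambda>t. integral {a..t} f)"
    unfolding continuous_on_eq_continuous_within
  proof
    fix t assume t: "t \<in> {a..}"
    have "continuous (at t within {a..t + 1}) (\<lambda>t. integral {a..t} f)"
      using deriv[of t "t + 1"] t by (intro DERIV_continuous) auto
    moreover have "at t within {a..} = at t within {a..t + 1}"
      by (rule at_within_nhd[of _ "{..<t + 1}"]) auto
    ultimately show "continuous (at t within {a..}) (\<lambda>t. integral {a..t} f)" by simp
  qed
  show "((\<lambda>t. integral {a..t} f) has_real_derivative f t) (at t)" if "a < t"
    using deriv[of t "t + 1"] that by (simp add: at_within_interior[of t "{a..t + 1}"])
qed

text \<open>
  The primitive \<open>\<Phi>\<close> of the maximal speed.  Before time \<open>0\<close> the speed is only integrable,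
  afterwards it is continuous and \<open>\<Phi>\<close> is differentiable; hence the two separate speeds.
\<close>

lemma arc_length_primitive:
  fixes w0 w1 :: "real \<Rightarrow> real"
  assumes "a \<le> 0"
    and w0: "w0 integrable_on {a..0}" "\<And>s. 0 \<le> w0 s"
    and w1: "continuous_on {0..} w1" "\<And>s. 0 \<le> w1 s"
  obtains \<Phi> where "continuous_on {a..} \<Phi>" "\<And>s t. \<lbrakk>a \<le> s; s \<le> t\<rbrakk> \<Longrightarrow> \<Phi> s \<le> \<Phi> t"
    "\<And>t. 0 < t \<Longrightarrow> (\<Phi> has_real_derivative w1 t) (at t)"
    "\<And>s t. \<lbrakk>a \<le> s; s \<le> t; t \<le> 0\<rbrakk> \<Longrightarrow> \<Phi> t - \<Phi> s = integral {s..t} w0"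
    "\<And>s t. \<lbrakk>0 \<le> s; s \<le> t\<rbrakk> \<Longrightarrow> \<Phi> t - \<Phi> s = integral {s..t} w1"
proof -
  define \<Phi> where "\<Phi> t = (if t \<le> 0 then - integral {t..0} w0 else integral {0..t} w1)" for t
  have pos: "\<Phi> t = integral {0..t} w1" if "0 \<le> t" for t using that by (auto simp: \<Phi>_def)
  have int1: "w1 integrable_on {s..t}" if "0 \<le> s" for s t
    using that by (intro integrable_continuous_real continuous_on_subset[OF w1(1)]) auto
  have neg_diff: "\<Phi> t - \<Phi> s = integral {s..t} w0" if "a \<le> s" "s \<le> t" "t \<le> 0" for s t
  proof -
    have "w0 integrable_on {s..0}" using w0(1) that by (auto intro: integrable_on_subinterval)
    then have "integral {s..t} w0 + integral {t..0} w0 = integral {s..0} w0"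
      using that by (intro Henstock_Kurzweil_Integration.integral_combine) auto
    then show ?thesis using that by (simp add: \<Phi>_def)
  qed
  have pos_diff: "\<Phi> t - \<Phi> s = integral {s..t} w1" if "0 \<le> s" "s \<le> t" for s t
  proof -
    have "integral {0..s} w1 + integral {s..t} w1 = integral {0..t} w1"
      using that int1 by (intro Henstock_Kurzweil_Integration.integral_combine) auto
    then show ?thesis using that by (simp add: pos)
  qed
  show thesis
  proof (rule that[OF _ _ _ neg_diff pos_diff])
    have "continuous_on {a..0} (\<lambda>t. - integral {t..0} w0)"
      by (intro continuous_intros indefinite_integral_continuous_1' w0)
    then have "continuous_on {a..0} \<Phi>" by (rule continuous_on_cong[THEN iffD1, rotated 2]) (auto simp: \<Phi>_def)
    moreover have "continuous_on {0..} \<Phi>"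
      using integral_from_left_endpoint(1)[OF w1(1)]
      by (rule continuous_on_cong[THEN iffD1, rotated 2]) (auto simp: pos)
    ultimately have "continuous_on ({a..0} \<union> {0..}) \<Phi>"
      by (intro continuous_on_closed_Un) auto
    moreover have "{a..} = {a..0} \<union> {0..}" using \<open>a \<le> 0\<close> by auto
    ultimately show "continuous_on {a..} \<Phi>" by simp
    show "(\<Phi> has_real_derivative w1 t) (at t)" if "0 < t" for t
      by (rule has_field_derivative_transform_within_open[OF integral_from_left_endpoint(2)[OF w1(1) that], of "{0<..}"])
         (use that in \<open>auto simp: pos\<close>)
    have neg_mono: "\<Phi> s \<le> \<Phi> t" if "a \<le> s" "s \<le> t" "t \<le> 0" for s t
      using neg_diff[OF that] integral_nonneg[of w0 "{s..t}"] w0(2)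
        integrable_on_subinterval[OF w0(1), of s t] that by auto
    have pos_mono: "\<Phi> s \<le> \<Phi> t" if "0 \<le> s" "s \<le> t" for s t
      using pos_diff[OF that] integral_nonneg[OF int1[OF that(1)], of t] w1(2) by auto
    show "\<Phi> s \<le> \<Phi> t" if "a \<le> s" "s \<le> t" for s t
    proof -
      consider "t \<le> 0" | "0 \<le> s" | "s \<le> 0" "0 \<le> t" by linarith
      then show ?thesis
      proof cases
        case 3
        then show ?thesis using neg_mono[of s 0] pos_mono[of 0 t] that by simp
      qed (use that neg_mono pos_mono in auto)
    qed
  qed
qed

text \<open>
  The delayed time \<open>t - \<tau> t\<close> increases with speed at least \<open>1 - c\<close>; in particular it never falls below
  its initial value \<open>- \<tau> 0\<close>.
\<close>

locale slow_delay =
  fixes \<tau> :: "real \<Rightarrow> real" and c :: real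
  assumes c: "0 < c" "c < 1"
    and \<tau>: "0 \<le> t \<Longrightarrow> 0 \<le> \<tau> t"
    and \<tau>_lip: "\<lbrakk>0 \<le> s; s \<le> t\<rbrakk> \<Longrightarrow> \<bar>\<tau> t - \<tau> s\<bar> \<le> c * (t - s)"
begin

lemma delayed_time_increment:
  assumes "0 \<le> s" "s \<le> t"
  shows "(1 - c) * (t - s) \<le> (t - \<tau> t) - (s - \<tau> s)"
  using \<tau>_lip[OF assms] by (simp add: abs_le_iff algebra_simps)

lemma delayed_time_ge: "0 \<le> t \<Longrightarrow> - \<tau> 0 \<le> t - \<tau> t"
proof -
  assume "0 \<le> t"
  then have "0 \<le> (1 - c) * (t - 0)" using c by simp
  also have "\<dots> \<le> (t - \<tau> t) - (0 - \<tau> 0)" using \<open>0 \<le> t\<close> by (intro delayed_time_increment) auto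
  finally show ?thesis by simp
qed

lemma continuous_on_delay: "continuous_on {0..} \<tau>"
proof (rule lipschitz_on_continuous_on)
  show "c-lipschitz_on {0..} \<tau>"
  proof (rule lipschitz_onI)
    fix s t :: real assume "s \<in> {0..}" "t \<in> {0..}"
    then show "dist (\<tau> s) (\<tau> t) \<le> c * dist s t"
      using \<tau>_lip[of s t] \<tau>_lip[of t s]
      by (cases "s \<le> t") (auto simp: dist_real_def abs_minus_commute)
  qed (use c in simp)
qed

lemma continuous_on_delayed:
  assumes "continuous_on {- \<tau> 0..} f"
  shows "continuous_on {0..} (\<lambda>t. f (t - \<tau> t))"
  by (rule continuous_on_compose2[OF assms])
     (use delayed_time_ge in \<open>auto intro!: continuous_intros continuous_on_delay\<close>)

end

locale delay_memory = slow_delay +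
  fixes \<Phi> :: "real \<Rightarrow> real"
  assumes \<Phi>_cont: "continuous_on {- \<tau> 0..} \<Phi>"
    and \<Phi>_mono: "\<lbrakk>- \<tau> 0 \<le> s; s \<le> t\<rbrakk> \<Longrightarrow> \<Phi> s \<le> \<Phi> t"
begin

definition memory_term :: "real \<Rightarrow> real" where
  "memory_term t = exp (- t) * integral {t - \<tau> t..t} (\<lambda>s. exp s * (\<Phi> t - \<Phi> s))"

lemma weighted_gap_integrable: "- \<tau> 0 \<le> \<rho> \<Longrightarrow> (\<lambda>s. exp s * (k - \<Phi> s)) integrable_on {\<rho>..\<rho>'}"
  by (intro integrable_continuous_real continuous_intros continuous_on_subset[OF \<Phi>_cont]) auto

text \<open>
  In this form the dependence on the end points and on \<open>k\<close> is separated, which gives continuity and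
  differentiability of the memory term.
\<close>

lemma weighted_gap_integral:
  assumes "- \<tau> 0 \<le> \<rho>" "\<rho> \<le> \<rho>'"
  shows "integral {\<rho>..\<rho>'} (\<lambda>s. exp s * (k - \<Phi> s)) = k * (exp \<rho>' - exp \<rho>) -
    (integral {- \<tau> 0..\<rho>'} (\<lambda>s. exp s * \<Phi> s) - integral {- \<tau> 0..\<rho>} (\<lambda>s. exp s * \<Phi> s))"
proof -
  have int: "(\<lambda>s. exp s * \<Phi> s) integrable_on {s..t}" if "- \<tau> 0 \<le> s" for s t
    using that by (intro integrable_continuous_real continuous_intros continuous_on_subset[OF \<Phi>_cont]) auto
  have "((\<lambda>s. k * exp s) has_integral (k * exp \<rho>' - k * exp \<rho>)) {\<rho>..\<rho>'}"
    using assms(2) by (intro fundamental_theorem_of_calculus)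
      (auto intro!: derivative_eq_intros simp: has_real_derivative_iff_has_vector_derivative[symmetric])
  from has_integral_diff[OF this integrable_integral[OF int[OF assms(1)]]]
  have "integral {\<rho>..\<rho>'} (\<lambda>s. exp s * (k - \<Phi> s)) = k * (exp \<rho>' - exp \<rho>) - integral {\<rho>..\<rho>'} (\<lambda>s. exp s * \<Phi> s)"
    by (intro integral_unique) (simp add: algebra_simps)
  moreover have "integral {- \<tau> 0..\<rho>} (\<lambda>s. exp s * \<Phi> s) + integral {\<rho>..\<rho>'} (\<lambda>s. exp s * \<Phi> s)
      = integral {- \<tau> 0..\<rho>'} (\<lambda>s. exp s * \<Phi> s)"
    using assms int by (intro Henstock_Kurzweil_Integration.integral_combine) auto
  ultimately show ?thesis by simp
qed

lemma memory_term_nonneg: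
  assumes "0 \<le> t"
  shows "0 \<le> memory_term t"
  unfolding memory_term_def
  using \<Phi>_mono delayed_time_ge[OF assms]
  by (intro mult_nonneg_nonneg integral_nonneg weighted_gap_integrable) auto

lemma continuous_on_memory_term: "continuous_on {0..} memory_term"
proof -
  let ?P = "\<lambda>t. integral {- \<tau> 0..t} (\<lambda>s. exp s * \<Phi> s)"
  have P: "continuous_on {- \<tau> 0..} ?P"
    by (intro integral_from_left_endpoint continuous_intros \<Phi>_cont)
  have sub: "{0..} \<subseteq> {- \<tau> 0..}" using \<tau>[of 0] by auto
  have "continuous_on {0..} (\<lambda>t. exp (- t) * (\<Phi> t * (exp t - exp (t - \<tau> t)) - (?P t - ?P (t - \<tau> t))))"
    by (intro continuous_intros continuous_on_delay continuous_on_delayed[OF P]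
        continuous_on_subset[OF P sub] continuous_on_subset[OF \<Phi>_cont sub])
  then show ?thesis
    by (rule continuous_on_cong[THEN iffD1, rotated 2])
       (use delayed_time_ge \<tau> in \<open>auto simp: memory_term_def weighted_gap_integral\<close>)
qed

text \<open>
  With the lower limit \<open>\<rho> = t - \<tau> t\<close> frozen, the functional \<open>R\<close> is differentiable in its upper time and contributes
  \<open>w (1 - e\<^bsup>-\<tau> t\<^esup>) - W\<close>.  Moving the lower limit removes an integral over an interval of length at least
  \<open>(1 - c) h\<close> on which the integrand is at least about \<open>e\<^bsup>-\<tau> t\<^esup> (\<Phi> t - \<Phi> \<rho>)\<close>; this is the term \<open>B h\<close>.
\<close>

lemma memory_term_dini:
  assumes "0 < t" and w: "(\<Phi> has_real_derivative w) (at t)" "0 \<le> w" and \<tau>bar: "\<tau> t \<le> \<tau>bar"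
  shows "upper_dini_le memory_term t
    (\<tau>bar * w - memory_term t - (1 - c) * exp (- \<tau>bar) * (\<Phi> t - \<Phi> (t - \<tau> t)))"
proof -
  let ?P = "\<lambda>t. integral {- \<tau> 0..t} (\<lambda>s. exp s * \<Phi> s)"
  define \<rho> where "\<rho> = t - \<tau> t"
  have \<rho>: "- \<tau> 0 \<le> \<rho>" "\<rho> \<le> t" using delayed_time_ge[of t] \<tau>[of t] \<open>0 < t\<close> by (auto simp: \<rho>_def)
  define R where "R s = exp (- s) * (\<Phi> s * (exp s - exp \<rho>) - (?P s - ?P \<rho>))" for s
  have R_eq: "R s = exp (- s) * integral {\<rho>..s} (\<lambda>\<sigma>. exp \<sigma> * (\<Phi> s - \<Phi> \<sigma>))" if "\<rho> \<le> s" for s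
    using weighted_gap_integral[OF \<rho>(1) that] by (simp add: R_def)
  have Rt: "R t = memory_term t" using R_eq[OF \<rho>(2)] by (simp add: memory_term_def \<rho>_def)
  have "- \<tau> 0 < t" using \<tau>[of 0] \<open>0 < t\<close> by simp
  then have P': "(?P has_real_derivative exp t * \<Phi> t) (at t)"
    by (intro integral_from_left_endpoint(2) continuous_intros \<Phi>_cont)
  have "(R has_real_derivative (w * (1 - exp (\<rho> - t)) - R t)) (at t)"
    unfolding R_def
    by (rule derivative_eq_intros w(1) P' refl)+ (simp add: exp_diff exp_minus field_simps)
  then have R': "((\<lambda>h. (R (t + h) - R t) / h) \<longlongrightarrow> w * (1 - exp (\<rho> - t)) - R t) (at_right 0)"
    unfolding DERIV_def by (rule tendsto_within_subset) auto
  define B where "B h = (1 - c) * exp (\<rho> - (t + h)) * (\<Phi> (t + h) - \<Phi> ((t + h) - \<tau> (t + h)))" for h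
  have "continuous_on {0..} (\<lambda>s. (1 - c) * exp (\<rho> - s) * (\<Phi> s - \<Phi> (s - \<tau> s)))"
    by (intro continuous_intros continuous_on_delayed \<Phi>_cont continuous_on_subset[OF \<Phi>_cont])
       (use \<tau>[of 0] in auto)
  then have "continuous_on {0..} B"
    unfolding B_def
    by (rule continuous_on_compose2) (use \<open>0 < t\<close> in \<open>auto intro!: continuous_intros\<close>)
  then have "(B \<longlongrightarrow> B 0) (at 0 within {0..})" by (simp add: continuous_on_def)
  then have "(B \<longlongrightarrow> B 0) (at_right 0)" by (simp add: at_within_Ici_at_right)
  from tendsto_diff[OF R' this]
  have lim: "((\<lambda>h. (R (t + h) - R t) / h - B h) \<longlongrightarrow> w * (1 - exp (\<rho> - t)) - R t - B 0) (at_right 0)" .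
  have "memory_term (t + h) \<le> memory_term t + h * ((R (t + h) - R t) / h - B h)" if "0 < h" for h
  proof -
    define t' \<rho>' where "t' = t + h" and "\<rho>' = t' - \<tau> t'"
    have inc: "(1 - c) * h \<le> \<rho>' - \<rho>"
      using delayed_time_increment[of t t'] that \<open>0 < t\<close> by (simp add: t'_def \<rho>'_def \<rho>_def)
    moreover have "0 \<le> (1 - c) * h" using c that by simp
    ultimately have \<rho>': "\<rho> \<le> \<rho>'" "\<rho>' \<le> t'" using \<tau>[of t'] \<open>0 < t\<close> that by (auto simp: \<rho>'_def t'_def)
    have gap: "0 \<le> \<Phi> t' - \<Phi> \<rho>'" using \<Phi>_mono[of \<rho>' t'] \<rho> \<rho>' by simp
    let ?I = "\<lambda>x y. integral {x..y} (\<lambda>s. exp s * (\<Phi> t' - \<Phi> s))"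
    have "?I \<rho> \<rho>' + ?I \<rho>' t' = ?I \<rho> t'"
      using \<rho> \<rho>' by (intro Henstock_Kurzweil_Integration.integral_combine weighted_gap_integrable) auto
    moreover have "memory_term t' = exp (- t') * ?I \<rho>' t'" by (simp add: memory_term_def \<rho>'_def)
    moreover have "R t' = exp (- t') * ?I \<rho> t'" using R_eq[of t'] \<rho>' by linarith
    ultimately have "memory_term t' = R t' - exp (- t') * ?I \<rho> \<rho>'"
      by (metis add_diff_cancel_left' right_diff_distrib)
    moreover have "h * B h \<le> exp (- t') * ?I \<rho> \<rho>'"
    proof -
      have "h * B h = exp (- t') * (((1 - c) * h) * (exp \<rho> * (\<Phi> t' - \<Phi> \<rho>')))"
      proof -
        have "exp (\<rho> - (t + h)) = exp (- t') * exp \<rho>" by (simp add: mult_exp_exp t'_def)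
        then show ?thesis by (simp add: B_def t'_def \<rho>'_def)
      qed
      also have "\<dots> \<le> exp (- t') * ((\<rho>' - \<rho>) * (exp \<rho> * (\<Phi> t' - \<Phi> \<rho>')))"
        using inc gap by (intro mult_left_mono mult_right_mono) auto
      also have "(\<rho>' - \<rho>) * (exp \<rho> * (\<Phi> t' - \<Phi> \<rho>')) = integral {\<rho>..\<rho>'} (\<lambda>s. exp \<rho> * (\<Phi> t' - \<Phi> \<rho>'))"
        using \<rho>' by simp
      also have "\<dots> \<le> ?I \<rho> \<rho>'"
      proof (rule integral_le)
        fix s assume s: "s \<in> {\<rho>..\<rho>'}"
        have "\<Phi> s \<le> \<Phi> \<rho>'" using \<Phi>_mono[of s \<rho>'] \<rho> s by auto
        then show "exp \<rho> * (\<Phi> t' - \<Phi> \<rho>') \<le> exp s * (\<Phi> t' - \<Phi> s)"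
          using s gap by (intro mult_mono) auto
      qed (use \<rho> in \<open>auto intro: weighted_gap_integrable\<close>)
      finally show ?thesis by (simp add: mult_left_mono)
    qed
    moreover have "h * ((R (t + h) - R t) / h - B h) = R t' - R t - h * B h"
      using that by (simp add: t'_def right_diff_distrib[of h _ "B h"])
    ultimately show ?thesis using Rt by (simp add: t'_def)
  qed
  then have "\<forall>\<^sub>F h in at_right 0. memory_term (t + h) \<le> memory_term t + h * ((R (t + h) - R t) / h - B h)"
    by (intro eventually_mono[OF eventually_at_right_less[of "0::real"]])
  then have "upper_dini_le memory_term t (w * (1 - exp (\<rho> - t)) - R t - B 0)"
    using lim by (rule upper_dini_leI_tendsto)
  then show ?thesis
  proof (rule upper_dini_le_mono)
    have "1 - exp (- \<tau> t) \<le> \<tau>bar" using exp_ge_add_one_self[of "- \<tau> t"] \<tau>bar by simp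
    then have "w * (1 - exp (- \<tau> t)) \<le> w * \<tau>bar" using w(2) by (rule mult_left_mono)
    moreover have "(1 - c) * exp (- \<tau>bar) * (\<Phi> t - \<Phi> \<rho>) \<le> (1 - c) * exp (- \<tau> t) * (\<Phi> t - \<Phi> \<rho>)"
      using \<tau>bar c \<Phi>_mono[OF \<rho>] by (intro mult_right_mono mult_left_mono) auto
    ultimately show "w * (1 - exp (\<rho> - t)) - R t - B 0 \<le>
        \<tau>bar * w - memory_term t - (1 - c) * exp (- \<tau>bar) * (\<Phi> t - \<Phi> (t - \<tau> t))"
      unfolding Rt B_def by (simp add: \<rho>_def mult.commute)
  qed
qed

end
lemma velocity_diameter_eq_Max:
  "velocity_diameter N v t = (MAX p\<in>{1..N} \<times> {1..N}. norm (v (snd p) t - v (fst p) t))"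
proof -
  have "{norm (v j t - v i t) |i j. i \<in> {1..N} \<and> j \<in> {1..N}} =
      (\<lambda>p. norm (v (snd p) t - v (fst p) t)) ` ({1..N} \<times> {1..N})" by force
  then show ?thesis by (simp only: velocity_diameter_def)
qed

lemma velocity_diameter_le_iff:
  assumes "1 \<le> N"
  shows "velocity_diameter N v t \<le> B \<longleftrightarrow> (\<forall>p\<in>{1..N}. \<forall>q\<in>{1..N}. norm (v p t - v q t) \<le> B)"
  unfolding velocity_diameter_eq_Max using assms by (subst Max_le_iff) auto

lemma continuous_on_velocity_diameter:
  assumes "1 \<le> N" "\<And>i. i \<in> {1..N} \<Longrightarrow> continuous_on S (v i)"
  shows "continuous_on S (velocity_diameter N v)"
  unfolding velocity_diameter_eq_Max[abs_def]
  using assms by (intro continuous_on_Max_family continuous_intros) auto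

text \<open>
  For small \<open>h\<close> the point \<open>u + h u'\<close> is \<open>(1 - l h) u + h (u' + l u)\<close>.  The number \<open>d\<close> only bounds the
  norm at time \<open>t\<close>, so that the estimate can be applied with the diameter for \<open>d\<close> to every pair of
  agents, including those that do not realise it.
\<close>

lemma norm_growth_bound:
  fixes u :: "real \<Rightarrow> 'a::real_normed_vector"
  assumes der: "(u has_vector_derivative u') (at t)" and "norm (u t) \<le> d"
    and K: "norm (u' + l *\<^sub>R u t) \<le> K" and "0 < l" "0 < \<epsilon>"
  shows "\<forall>\<^sub>F h in at_right 0. norm (u (t + h)) \<le> d + h * (K - l * d + \<epsilon>)"
proof -
  obtain \<delta> where \<delta>: "0 < \<delta>" "\<And>s. norm (s - t) < \<delta> \<Longrightarrow> norm (u s - u t - (s - t) *\<^sub>R u') \<le> \<epsilon> * norm (s - t)"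
    using der \<open>0 < \<epsilon>\<close> unfolding has_vector_derivative_def has_derivative_at_alt by blast
  have "\<forall>\<^sub>F h in at_right (0::real). 0 < h" by (rule eventually_at_right_less)
  moreover have "\<forall>\<^sub>F h in at_right 0. h < \<delta>" by (rule eventually_at_right_0_less[OF \<delta>(1)])
  moreover have "\<forall>\<^sub>F h in at_right 0. h < 1 / l" using \<open>0 < l\<close> by (intro eventually_at_right_0_less) simp
  ultimately show ?thesis
  proof eventually_elim
    case (elim h)
    have lh: "0 \<le> 1 - l * h" using elim \<open>0 < l\<close> by (simp add: field_simps)
    have "u (t + h) = (u (t + h) - u t - h *\<^sub>R u') + ((1 - l * h) *\<^sub>R u t + h *\<^sub>R (u' + l *\<^sub>R u t))"
      by (simp add: algebra_simps)
    also have "norm \<dots> \<le> norm (u (t + h) - u t - h *\<^sub>R u') + (norm ((1 - l * h) *\<^sub>R u t) + norm (h *\<^sub>R (u' + l *\<^sub>R u t)))"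
      by (intro norm_triangle_mono norm_triangle_ineq order_refl)
    also have "\<dots> \<le> \<epsilon> * h + ((1 - l * h) * d + h * K)"
    proof (intro add_mono)
      show "norm (u (t + h) - u t - h *\<^sub>R u') \<le> \<epsilon> * h" using \<delta>(2)[of "t + h"] elim by simp
      show "norm ((1 - l * h) *\<^sub>R u t) \<le> (1 - l * h) * d" using lh assms(2) by (simp add: mult_left_mono)
      show "norm (h *\<^sub>R (u' + l *\<^sub>R u t)) \<le> h * K" using elim K by (simp add: mult_left_mono)
    qed
    finally show ?case by (simp add: algebra_simps)
  qed
qed

text \<open>
  The velocity differences satisfy \<open>|(v\<^sub>p - v\<^sub>q)' + lam (v\<^sub>p - v\<^sub>q)| \<le> lam (1 - \<psi>) d + 2 lam \<sigma>\<close>; the growth bound then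
  holds for all pairs at once, hence for their maximum.
\<close>

lemma velocity_diameter_dini:
  fixes v :: "nat \<Rightarrow> real \<Rightarrow> real ^ 'd" and A :: "nat \<Rightarrow> nat \<Rightarrow> real"
  assumes "1 \<le> N" "0 < lam"
    and der: "\<And>i. i \<in> {1..N} \<Longrightarrow> (v i has_vector_derivative v' i) (at t)"
    and A: "\<And>i j. \<lbrakk>i \<in> {1..N}; j \<in> {1..N}\<rbrakk> \<Longrightarrow> 0 \<le> A i j" "\<And>i. i \<in> {1..N} \<Longrightarrow> (\<Sum>j\<in>{1..N}. A i j) = 1"
    and \<psi>: "\<And>p q. \<lbrakk>p \<in> {1..N}; q \<in> {1..N}\<rbrakk> \<Longrightarrow>
      \<psi> \<le> (\<Sum>i\<in>{1..N}. \<Sum>j\<in>{1..N}. min (A p i * A q j) (A p j * A q i))"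
    and v': "\<And>i. i \<in> {1..N} \<Longrightarrow> norm (v' i - lam *\<^sub>R ((\<Sum>j\<in>{1..N}. A i j *\<^sub>R v j t) - v i t)) \<le> lam * \<sigma>"
  shows "upper_dini_le (velocity_diameter N v) t (2 * lam * \<sigma> - lam * \<psi> * velocity_diameter N v t)"
  unfolding upper_dini_le_def
proof (intro allI impI)
  fix \<epsilon> :: real assume "0 < \<epsilon>"
  let ?I = "{1..N}" and ?d = "velocity_diameter N v t"
  have d: "norm (v p t - v q t) \<le> ?d" if "p \<in> ?I" "q \<in> ?I" for p q
    using velocity_diameter_le_iff[OF \<open>1 \<le> N\<close>, of v t ?d] that by auto
  define M where "M i = (\<Sum>j\<in>?I. A i j *\<^sub>R v j t)" for i
  define K where "K = lam * ((1 - \<psi>) * ?d) + (lam * \<sigma> + lam * \<sigma>)"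
  have K: "norm ((v' p - v' q) + lam *\<^sub>R (v p t - v q t)) \<le> K" if pq: "p \<in> ?I" "q \<in> ?I" for p q
  proof -
    have "(v' p - v' q) + lam *\<^sub>R (v p t - v q t) =
       lam *\<^sub>R (M p - M q) + ((v' p - lam *\<^sub>R (M p - v p t)) - (v' q - lam *\<^sub>R (M q - v q t)))"
      by (simp add: algebra_simps)
    also have "norm \<dots> \<le> norm (lam *\<^sub>R (M p - M q)) +
        (norm (v' p - lam *\<^sub>R (M p - v p t)) + norm (v' q - lam *\<^sub>R (M q - v q t)))"
      by (intro norm_triangle_mono norm_triangle_ineq4 order_refl)
    also have "\<dots> \<le> lam * ((1 - \<psi>) * ?d) + (lam * \<sigma> + lam * \<sigma>)"
    proof (intro add_mono)
      have "norm (M p - M q) \<le> (1 - \<psi>) * ?d"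
        unfolding M_def by (rule convex_means_contract) (use A \<psi> d pq in auto)
      then show "norm (lam *\<^sub>R (M p - M q)) \<le> lam * ((1 - \<psi>) * ?d)"
        using \<open>0 < lam\<close> by (simp add: mult_left_mono)
    qed (use v' pq in \<open>auto simp: M_def\<close>)
    finally show ?thesis by (simp add: K_def)
  qed
  have "\<forall>\<^sub>F h in at_right 0. \<forall>p\<in>?I. \<forall>q\<in>?I. norm (v p (t + h) - v q (t + h)) \<le> ?d + h * (K - lam * ?d + \<epsilon>)"
    using norm_growth_bound[OF has_vector_derivative_diff[OF der der] d K \<open>0 < lam\<close> \<open>0 < \<epsilon>\<close>]
    by (intro eventually_ball_finite ballI) auto
  then show "\<forall>\<^sub>F h in at_right 0. velocity_diameter N v (t + h) \<le>
      ?d + h * (2 * lam * \<sigma> - lam * \<psi> * ?d + \<epsilon>)"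
  proof eventually_elim
    case (elim h)
    then have "velocity_diameter N v (t + h) \<le> ?d + h * (K - lam * ?d + \<epsilon>)"
      by (simp add: velocity_diameter_le_iff[OF \<open>1 \<le> N\<close>])
    then show ?case by (simp add: K_def algebra_simps)
  qed
qed
section \<open>Exponential decay of the velocity diameter\<close>

theorem theorem3p1:
  fixes N :: nat and lam c \<tau>bar \<psi> \<tau>0 r C :: real
    and \<tau> :: "real \<Rightarrow> real"
    and a :: "nat \<Rightarrow> nat \<Rightarrow> real \<Rightarrow> real"
    and f g x v :: "nat \<Rightarrow> real \<Rightarrow> real ^ 'd"
  assumes "2 \<le> N" and "0 < lam"
    and "admissible_delay \<tau> \<tau>bar c"
    and "admissible_weights N (- \<tau> 0) a"
    and "\<And>i. i \<in> {1..N} \<Longrightarrow> continuous_on {- \<tau> 0..0} (f i)"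
    and "\<And>i. i \<in> {1..N} \<Longrightarrow> abs_continuous_on {- \<tau> 0..0} (g i)"
    and "delayed_CS_solution N lam \<tau> a f g x v"
    and "0 < \<psi>"
    and "\<And>t p q. \<lbrakk>- \<tau> 0 \<le> t; p \<in> {1..N}; q \<in> {1..N}\<rbrakk> \<Longrightarrow>
           1 / (real N)\<^sup>2 *
             (\<Sum>i\<in>{1..N}. \<Sum>j\<in>{1..N}. min (a q i t * a p j t) (a q j t * a p i t)) \<ge> \<psi>"
    and "\<tau>0 = (1 - c) / lam * (\<psi> / (\<psi> + 2))"
    and "\<tau>bar * exp \<tau>bar \<in> {0<..<\<tau>0}"
    and "r = min (lam * (\<psi> - 2 * lam * \<tau>bar / ((1 - c) * exp (- \<tau>bar) - lam * \<tau>bar))) 1"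
    and "C = velocity_diameter N v 0 +
           2 * lam / ((1 - c) * exp (- \<tau>bar) - lam * \<tau>bar) *
           (LINT s:{- \<tau> 0..0}|lebesgue. exp s *
             (LINT \<sigma>:{s..0}|lebesgue.
               (MAX j\<in>{1..N}. norm (vector_derivative (g j) (at \<sigma> within {- \<tau> 0..0})))))"
  shows "\<forall>t\<ge>0. velocity_diameter N v t \<le> C * exp (- r * t)"
proof -
  let ?I = "{1..N}" and ?d = "velocity_diameter N v"
  have N: "1 \<le> N" and I: "finite ?I" "?I \<noteq> {}" using \<open>2 \<le> N\<close> by auto
  have \<tau>: "\<And>t. 0 \<le> t \<Longrightarrow> 0 \<le> \<tau> t" and c: "0 < c" "c < 1"
    and \<tau>bar: "0 < \<tau>bar" "\<And>t. 0 < t \<Longrightarrow> \<tau> t \<le> \<tau>bar"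
    using assms(3) by (auto simp: admissible_delay_def)
  interpret slow_delay \<tau> c
    by unfold_locales (use c \<tau> admissible_delay_lipschitz[OF assms(3)] in auto)
  have start: "- \<tau> 0 \<le> 0" using \<tau>[of 0] by simp
  have a_cont: "continuous_on {- \<tau> 0..} (a i j)" if "i \<in> ?I" "j \<in> ?I" "i \<noteq> j" for i j
    using assms(4) that unfolding admissible_weights_def by blast
  have a_diag: "a i i t = real N - (\<Sum>j\<in>?I - {i}. a i j t)" "0 < a i i t" if "i \<in> ?I" "- \<tau> 0 \<le> t" for i t
  proof -
    show eq: "a i i t = real N - (\<Sum>j\<in>?I - {i}. a i j t)"
      using assms(4) that unfolding admissible_weights_def by blast
    have "1 / real N * (\<Sum>j\<in>?I - {i}. a i j t) < 1"
      using assms(4) that unfolding admissible_weights_def by blast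
    then show "0 < a i i t" using eq N by (simp add: field_simps)
  qed
  have a_pos: "0 < a i j t" if "i \<in> ?I" "j \<in> ?I" "- \<tau> 0 \<le> t" for i j t
    using assms(4) a_diag(2) that unfolding admissible_weights_def by (cases "i = j") auto
  have v_cont: "continuous_on {- \<tau> 0..} (v i)" and v_init: "\<And>t. t \<in> {- \<tau> 0..0} \<Longrightarrow> v i t = g i t"
    if "i \<in> ?I" for i
    using assms(7) that unfolding delayed_CS_solution_def by auto
  define v' where "v' i t = (lam / real N) *\<^sub>R
      (\<Sum>j\<in>?I - {i}. a i j (t - \<tau> t) *\<^sub>R (v j (t - \<tau> t) - v i t))" for i t
  have v_deriv: "(v i has_vector_derivative v' i t) (at t)" if "i \<in> ?I" "0 < t" for i t
    using assms(7) that unfolding delayed_CS_solution_def v'_def by blast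
  have sub: "{0..} \<subseteq> {- \<tau> 0..}" using start by auto
  have v'_cont: "continuous_on {0..} (v' i)" if "i \<in> ?I" for i
    unfolding v'_def using that
    by (intro continuous_intros continuous_on_delayed a_cont v_cont
        continuous_on_subset[OF v_cont sub]) auto

  \<comment> \<open>The maximal speeds before and after time \<open>0\<close>, and their common primitive \<open>\<Phi>\<close>.\<close>
  define w0 where "w0 \<sigma> = (MAX j\<in>?I. norm (vector_derivative (g j) (at \<sigma> within {- \<tau> 0..0})))" for \<sigma>
  define w1 where "w1 t = (MAX j\<in>?I. norm (v' j t))" for t
  have w0: "w0 absolutely_integrable_on {- \<tau> 0..0}"
    unfolding w0_def by (intro abs_continuous_max_speed(1) I assms(6))
  have w0_nonneg: "0 \<le> w0 \<sigma>" for \<sigma>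
    unfolding w0_def by (rule abs_continuous_max_speed(3)[where b = 0, OF I]) (rule assms(6))
  have w0_bound: "norm (g j t - g j s) \<le> integral {s..t} w0" if "j \<in> ?I" "- \<tau> 0 \<le> s" "s \<le> t" "t \<le> 0" for j s t
    unfolding w0_def by (intro abs_continuous_max_speed(2) I assms(6) that)
  have w1_cont: "continuous_on {0..} w1"
    unfolding w1_def by (intro continuous_on_Max_family I continuous_intros v'_cont)
  have w1_ge: "norm (v' j t) \<le> w1 t" if "j \<in> ?I" for j t
    unfolding w1_def using I that by (intro Max_ge) auto
  have w1_nonneg: "0 \<le> w1 t" for t using w1_ge I by (meson all_not_in_conv norm_ge_zero order_trans)
  obtain \<Phi> where \<Phi>_cont: "continuous_on {- \<tau> 0..} \<Phi>"
    and \<Phi>_mono: "\<And>s t. \<lbrakk>- \<tau> 0 \<le> s; s \<le> t\<rbrakk> \<Longrightarrow> \<Phi> s \<le> \<Phi> t"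
    and \<Phi>_deriv: "\<And>t. 0 < t \<Longrightarrow> (\<Phi> has_real_derivative w1 t) (at t)"
    and \<Phi>_neg: "\<And>s t. \<lbrakk>- \<tau> 0 \<le> s; s \<le> t; t \<le> 0\<rbrakk> \<Longrightarrow> \<Phi> t - \<Phi> s = integral {s..t} w0"
    and \<Phi>_pos: "\<And>s t. \<lbrakk>0 \<le> s; s \<le> t\<rbrakk> \<Longrightarrow> \<Phi> t - \<Phi> s = integral {s..t} w1"
    by (rule arc_length_primitive[OF start set_lebesgue_integral_eq_integral(1)[OF w0] w0_nonneg w1_cont w1_nonneg])
       (rule that)
  have incr_neg: "norm (v j t - v j s) \<le> \<Phi> t - \<Phi> s" if "j \<in> ?I" "- \<tau> 0 \<le> s" "s \<le> t" "t \<le> 0" for j s t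
    using w0_bound[OF that] \<Phi>_neg[OF that(2-4)] v_init that by simp
  have incr_pos: "norm (v j t - v j s) \<le> \<Phi> t - \<Phi> s" if "j \<in> ?I" "0 \<le> s" "s \<le> t" for j s t
  proof -
    have "(v' j has_integral (v j t - v j s)) {s..t}"
      using that v_deriv v_cont[OF that(1)] start
      by (intro fundamental_theorem_of_calculus_interior) (auto intro: continuous_on_subset)
    moreover have "w1 integrable_on {s..t}"
      using that by (intro integrable_continuous_real continuous_on_subset[OF w1_cont]) auto
    ultimately have "norm (v j t - v j s) \<le> integral {s..t} w1"
      using w1_ge[OF that(1)] integral_norm_bound_integral[of "v' j" "{s..t}" w1]
      by (metis has_integral_integrable integral_unique)
    then show ?thesis using \<Phi>_pos that by simp
  qed
  \<comment> \<open>The delay may reach across time \<open>0\<close>, so increments over both regimes are needed.\<close>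
  have incr: "norm (v j t - v j s) \<le> \<Phi> t - \<Phi> s" if "j \<in> ?I" "- \<tau> 0 \<le> s" "s \<le> t" for j s t
  proof -
    consider "t \<le> 0" | "0 \<le> s" | "s \<le> 0" "0 \<le> t" by linarith
    then show ?thesis
    proof cases
      case 3
      have "norm (v j t - v j s) \<le> norm (v j t - v j 0) + norm (v j 0 - v j s)"
        using norm_triangle_ineq[of "v j t - v j 0" "v j 0 - v j s"] by simp
      then show ?thesis using incr_pos[of j 0 t] incr_neg[of j s 0] 3 that by simp
    qed (use that incr_neg incr_pos in auto)
  qed

  \<comment> \<open>The weight \<open>\<beta>\<close> is chosen such that the terms in \<open>\<sigma>\<close> cancel in the derivative of \<open>L\<close>.\<close>
  define \<kappa> where "\<kappa> = (1 - c) * exp (- \<tau>bar) - lam * \<tau>bar"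
  have \<kappa>: "0 < \<kappa>"
  proof -
    have "\<tau>bar * exp \<tau>bar < (1 - c) / lam * (\<psi> / (\<psi> + 2))" using assms(10,11) by simp
    also have "\<dots> \<le> (1 - c) / lam * 1"
      using c \<open>0 < lam\<close> \<open>0 < \<psi>\<close> by (intro mult_left_mono) auto
    finally have "lam * \<tau>bar * exp \<tau>bar < 1 - c" using \<open>0 < lam\<close> by (simp add: field_simps)
    then show ?thesis by (simp add: \<kappa>_def exp_minus field_simps)
  qed
  define \<beta> where "\<beta> = 2 * lam / \<kappa>"
  have \<beta>: "0 < \<beta>" "\<beta> * \<kappa> = 2 * lam" using \<kappa> \<open>0 < lam\<close> by (auto simp: \<beta>_def)
  have "lam * (\<psi> - 2 * lam * \<tau>bar / \<kappa>) = lam * \<psi> - \<beta> * lam * \<tau>bar"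
    by (simp add: \<beta>_def right_diff_distrib)
  then have r: "r \<le> lam * \<psi> - \<beta> * lam * \<tau>bar" "r \<le> 1"
    using assms(12)[folded \<kappa>_def] by simp_all
  interpret delay_memory \<tau> c \<Phi>
    by unfold_locales (use \<Phi>_cont \<Phi>_mono in auto)
  define W where "W = memory_term"
  have W_nonneg: "0 \<le> W t" if "0 \<le> t" for t
    unfolding W_def by (rule memory_term_nonneg[OF that])
  define L where "L t = ?d t + \<beta> * W t" for t
  have L_cont: "continuous_on {0..} L"
    unfolding L_def W_def
    by (intro continuous_intros continuous_on_velocity_diameter[OF N] continuous_on_subset[OF v_cont sub]
        continuous_on_memory_term)

  have L_dini: "upper_dini_le L t (- r * L t)" if "0 < t" for t
  proof -
    define s where "s = t - \<tau> t"
    have s: "- \<tau> 0 \<le> s" "s \<le> t" using delayed_time_ge[of t] \<tau>[of t] that by (auto simp: s_def)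
    define \<sigma> where "\<sigma> = \<Phi> t - \<Phi> s"
    define A where "A i j = a i j s / real N" for i j
    have A_nonneg: "0 \<le> A i j" if "i \<in> ?I" "j \<in> ?I" for i j
      using a_pos[OF that s(1)] by (simp add: A_def)
    have A_sum: "(\<Sum>j\<in>?I. A i j) = 1" if "i \<in> ?I" for i
    proof -
      have "(\<Sum>j\<in>?I. a i j s) = real N" using a_diag(1)[OF that s(1)] that by (simp add: sum.remove)
      then show ?thesis using N by (simp add: A_def sum_divide_distrib[symmetric])
    qed
    have rate: "norm (v' i t - lam *\<^sub>R ((\<Sum>j\<in>?I. A i j *\<^sub>R v j t) - v i t)) \<le> lam * \<sigma>" if "i \<in> ?I" for i
      unfolding v'_def A_def s_def[symmetric]
    proof (rule delayed_rate_perturbation)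
      show "norm (v j s - v j t) \<le> \<sigma>" if "j \<in> ?I" for j
        using incr[OF that s] by (simp add: \<sigma>_def norm_minus_commute)
    qed (use that a_pos a_diag s N \<open>0 < lam\<close> in \<open>auto simp: less_imp_le\<close>)
    have d: "norm (v p t - v q t) \<le> ?d t" if "p \<in> ?I" "q \<in> ?I" for p q
      using velocity_diameter_le_iff[OF N, of v t "?d t"] that by auto
    have speed: "w1 t \<le> lam * ?d t + lam * \<sigma>"
    proof -
      have "norm (v' i t) \<le> lam * ?d t + lam * \<sigma>" if "i \<in> ?I" for i
      proof -
        let ?M = "(\<Sum>j\<in>?I. A i j *\<^sub>R v j t) - v i t"
        have "norm ?M \<le> (\<Sum>j\<in>?I. A i j * ?d t)"
          unfolding mean_minus_point[OF A_sum[OF that]]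
          using that A_nonneg d by (intro sum_norm_le) (auto intro: mult_left_mono)
        also have "\<dots> = ?d t" using A_sum[OF that] by (simp add: sum_distrib_right[symmetric])
        finally have "norm (lam *\<^sub>R ?M) \<le> lam * ?d t" using \<open>0 < lam\<close> by (simp add: mult_left_mono)
        moreover have "norm (v' i t) \<le> norm (lam *\<^sub>R ?M) + norm (v' i t - lam *\<^sub>R ?M)"
          by (rule norm_triangle_sub)
        ultimately show ?thesis using rate[OF that] by linarith
      qed
      then show ?thesis unfolding w1_def using I by (simp add: Max_le_iff)
    qed
    have overlap: "\<psi> \<le> (\<Sum>i\<in>?I. \<Sum>j\<in>?I. min (A p i * A q j) (A p j * A q i))"
      if "p \<in> ?I" "q \<in> ?I" for p q
    proof -
      have "(\<Sum>i\<in>?I. \<Sum>j\<in>?I. min (A p i * A q j) (A p j * A q i)) =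
          1 / (real N)\<^sup>2 * (\<Sum>i\<in>?I. \<Sum>j\<in>?I. min (a p i s * a q j s) (a p j s * a q i s))"
        unfolding sum_distrib_left A_def
        by (intro sum.cong refl) (simp add: power2_eq_square min_divide_distrib_right)
      then show ?thesis using assms(9)[OF s(1) that(2,1)] by simp
    qed
    have "upper_dini_le ?d t (2 * lam * \<sigma> - lam * \<psi> * ?d t)"
      by (rule velocity_diameter_dini[OF N \<open>0 < lam\<close> v_deriv[OF _ that] A_nonneg A_sum overlap rate])
    moreover have "upper_dini_le W t (\<tau>bar * w1 t - W t - (1 - c) * exp (- \<tau>bar) * \<sigma>)"
      unfolding W_def \<sigma>_def s_def
      by (rule memory_term_dini[OF that \<Phi>_deriv[OF that] w1_nonneg \<tau>bar(2)[OF that]])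
    ultimately have "upper_dini_le L t ((2 * lam * \<sigma> - lam * \<psi> * ?d t) +
        \<beta> * (\<tau>bar * w1 t - W t - (1 - c) * exp (- \<tau>bar) * \<sigma>))"
      unfolding L_def using \<beta>(1) by (intro upper_dini_le_add upper_dini_le_cmult)
    then show ?thesis
    proof (rule upper_dini_le_mono)
      \<comment> \<open>Bounding the speed leaves a differential inequality in \<open>d\<close>, \<open>W\<close> and \<open>\<sigma>\<close> alone.\<close>
      have "\<tau>bar * w1 t \<le> \<tau>bar * (lam * ?d t + lam * \<sigma>)"
        using speed \<tau>bar(1) by (intro mult_left_mono) auto
      then have "\<beta> * (\<tau>bar * w1 t - W t - (1 - c) * exp (- \<tau>bar) * \<sigma>) \<le>
          \<beta> * (\<tau>bar * (lam * ?d t + lam * \<sigma>) - W t - (1 - c) * exp (- \<tau>bar) * \<sigma>)"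
        using \<beta>(1) by (intro mult_left_mono) auto
      also have "\<dots> = \<beta> * lam * \<tau>bar * ?d t - \<beta> * W t - \<beta> * \<kappa> * \<sigma>"
        by (simp add: \<kappa>_def algebra_simps)
      finally have "(2 * lam * \<sigma> - lam * \<psi> * ?d t) +
          \<beta> * (\<tau>bar * w1 t - W t - (1 - c) * exp (- \<tau>bar) * \<sigma>) \<le>
          - ((lam * \<psi> - \<beta> * lam * \<tau>bar) * ?d t) - \<beta> * W t"
        unfolding \<beta>(2) by (simp add: algebra_simps)
      also have "\<dots> \<le> - (r * ?d t) - r * (\<beta> * W t)"
      proof -
        have "0 \<le> ?d t" using d[of 1 1] N by simp
        then have "r * ?d t \<le> (lam * \<psi> - \<beta> * lam * \<tau>bar) * ?d t" using r(1) by (intro mult_right_mono)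
        moreover have "r * (\<beta> * W t) \<le> 1 * (\<beta> * W t)"
          using r(2) \<beta>(1) W_nonneg[of t] that by (intro mult_right_mono) auto
        ultimately show ?thesis by simp
      qed
      also have "\<dots> = - r * L t" by (simp add: L_def algebra_simps)
      finally show "(2 * lam * \<sigma> - lam * \<psi> * ?d t) +
          \<beta> * (\<tau>bar * w1 t - W t - (1 - c) * exp (- \<tau>bar) * \<sigma>) \<le> - r * L t" .
    qed
  qed

  \<comment> \<open>Before time \<open>0\<close> the increments of \<open>\<Phi>\<close> are the inner integrals of \<open>C\<close>.\<close>
  have "W 0 = (LINT s:{- \<tau> 0..0}|lebesgue. exp s * (LINT \<sigma>:{s..0}|lebesgue. w0 \<sigma>))"
  proof -
    have inner: "(LINT \<sigma>:{s..0}|lebesgue. w0 \<sigma>) = \<Phi> 0 - \<Phi> s" if "s \<in> {- \<tau> 0..0}" for s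
    proof -
      have "w0 absolutely_integrable_on {s..0}"
        by (rule set_integrable_subset[OF w0]) (use that in auto)
      then show ?thesis using \<Phi>_neg[of s 0] that by (simp add: set_lebesgue_integral_eq_integral(2))
    qed
    have "(LINT s:{- \<tau> 0..0}|lebesgue. exp s * (LINT \<sigma>:{s..0}|lebesgue. w0 \<sigma>)) =
        (LINT s:{- \<tau> 0..0}|lebesgue. exp s * (\<Phi> 0 - \<Phi> s))"
      using inner by (intro set_lebesgue_integral_cong) auto
    also have "\<dots> = integral {- \<tau> 0..0} (\<lambda>s. exp s * (\<Phi> 0 - \<Phi> s))"
      by (intro set_lebesgue_integral_eq_integral(2) absolutely_integrable_continuous_real
          continuous_intros continuous_on_subset[OF \<Phi>_cont]) auto
    finally show ?thesis by (simp add: W_def memory_term_def)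
  qed
  then have "C = L 0"
    using assms(13) by (simp add: L_def \<beta>_def \<kappa>_def w0_def)
  show ?thesis
  proof (intro allI impI)
    fix t :: real assume "0 \<le> t"
    have "?d t \<le> L t" using \<beta>(1) W_nonneg[OF \<open>0 \<le> t\<close>] by (simp add: L_def)
    also have "\<dots> \<le> C * exp (- r * t)"
      unfolding \<open>C = L 0\<close> by (rule upper_dini_exp_decay[OF L_cont L_dini \<open>0 \<le> t\<close>])
    finally show "?d t \<le> C * exp (- r * t)" .
  qed
qed

end
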